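(* For every $D>0$ there is a constant $C>0$ depending only on $D$ with the following property. Let $N\in\mathbb N$ and let $\{f_n\}_{n=1}^N$ be an orthonormal set of functions in $L_2[0,1]$ with $|f_n(x)|\le D$ for all $n$ and $x\in[0,1]$. Then there exist indices $1\le n_1<n_2<\dots<n_s\le N$ with $s\ge\max\{\lfloor\tfrac16\log_2N\rfloor,1\}$ such that for all $a_1,\dots,a_s\in\mathbb R$ and all $z>0$, $$C^{-1}\Big|\Big\{x\in[0,1]:\Big|\sum_{i=1}^s a_ir_i(x)\Big|>Cz\Big\}\Big|\le\Big|\Big\{x\in[0,1]:\Big|\sum_{i=1}^s a_if_{n_i}(x)\Big|>z\Big\}\Big|\le C\Big|\Big\{x\in[0,1]:\Big|\sum_{i=1}^s a_ir_i(x)\Big|>C^{-1}z\Big\}\Big|.$$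
   Context: $|\cdot|$ is Lebesgue measure; $r_i(x)=\operatorname{sign}\sin(2^{i-1}\pi x)$ are the Rademacher functions; $\lfloor\cdot\rfloor$ is the integer part. *)

theory Defs
  imports "HOL-Analysis.Analysis"
begin

definition rademacher :: "nat \<Rightarrow> real \<Rightarrow> real" where
  "rademacher i x = sgn (sin (2 ^ (i - 1) * pi * x))"

definition orthonormal_L2_01 :: "nat \<Rightarrow> (nat \<Rightarrow> real \<Rightarrow> real) \<Rightarrow> bool" where
  "orthonormal_L2_01 N f \<longleftrightarrow>
     (\<forall>n\<in>{1..N}. f n \<in> borel_measurable (lebesgue_on {0..1})) \<and>
     (\<forall>n\<in>{1..N}. \<forall>m\<in>{1..N}.
        integral\<^sup>L (lebesgue_on {0..1}) (\<lambda>x. f n x * f m x) = (if n = m then 1 else 0))"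

end

theory Submission
  imports Defs "HOL-Probability.Probability_Measure" "HOL-Real_Asymp.Real_Asymp"
begin

text \<open>For a sign vector \<open>e\<close> consider the Riesz product \<open>P\<^sub>e = \<Prod>\<^sub>i (1 + e\<^sub>i g\<^sub>i / D) \<ge> 0\<close>. Averaging over \<open>e\<close> turns the Rademacher
  sum \<open>R\<^sub>e = \<Sum> a\<^sub>i e\<^sub>i\<close> into \<open>F / D\<close> with \<open>F = \<Sum> a\<^sub>i g\<^sub>i\<close>; conversely, if the integrals of \<open>P g\<^sub>k\<close> and of \<open>g\<^sub>j\<^sup>2 P g\<^sub>k\<close>
  are small for all partial products \<open>P\<close> not involving \<open>g\<^sub>k\<close>, integrating \<open>F\<close> against \<open>P\<^sub>e\<close> returns
  \<open>R\<^sub>e / D\<close> up to an error of order \<open>\<parallel>a\<parallel>\<^sub>2\<close>. By Jensen's inequality all even moments of \<open>F\<close> and of the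
  Rademacher sum are then equivalent, up to constants to the power of the exponent. Together with
  \<open>\<parallel>R\<parallel>\<^sub>4\<^sub>m \<le> 2 \<parallel>R\<parallel>\<^sub>2\<^sub>m\<close> and the Paley-Zygmund inequality this yields the equivalence of the tails.

  The required smallness is obtained by choosing \<open>n\<^sub>i\<close> at random from the \<open>i\<close>-th of \<open>s\<close> consecutive blocks of
  length \<open>32\<^sup>s\<close>: by Bessel's inequality in the coordinate \<open>n\<^sub>k\<close>, each of the at most
  \<open>4\<^sup>s s (s + 1)\<close> integrals has mean square at most \<open>4\<^sup>s D\<^sup>4 / 32\<^sup>s\<close>.\<close>

section \<open>Tails from even moments\<close>

text \<open>A class closed under sums, products and powers, whose members are integrable on a finite
  measure space; it discharges the integrability conditions of the expectations below.\<close>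

definition bmeas :: "'a measure \<Rightarrow> ('a \<Rightarrow> real) \<Rightarrow> bool" where
  "bmeas M g \<longleftrightarrow> g \<in> borel_measurable M \<and> (\<exists>B. \<forall>x\<in>space M. \<bar>g x\<bar> \<le> B)"

lemma bmeasI: "g \<in> borel_measurable M \<Longrightarrow> (\<And>x. x \<in> space M \<Longrightarrow> \<bar>g x\<bar> \<le> B) \<Longrightarrow> bmeas M g"
  unfolding bmeas_def by blast

lemma bmeas_measurable: "bmeas M g \<Longrightarrow> g \<in> borel_measurable M"
  by (simp add: bmeas_def)

lemma bmeas_const [simp, intro]: "bmeas M (\<lambda>x. c)"
  by (auto simp: bmeas_def)

lemma bmeas_add [simp, intro]:
  assumes "bmeas M g" "bmeas M h"
  shows "bmeas M (\<lambda>x. g x + h x)"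
proof -
  obtain B B' where "\<forall>x\<in>space M. \<bar>g x\<bar> \<le> B" "\<forall>x\<in>space M. \<bar>h x\<bar> \<le> B'"
    using assms by (auto simp: bmeas_def)
  then show ?thesis
    using assms by (intro bmeasI[where B = "B + B'"]) (auto simp: bmeas_def intro: abs_triangle_ineq[THEN order_trans] add_mono)
qed

lemma bmeas_mult [simp, intro]:
  assumes "bmeas M g" "bmeas M h"
  shows "bmeas M (\<lambda>x. g x * h x)"
proof -
  obtain B B' where B: "\<forall>x\<in>space M. \<bar>g x\<bar> \<le> B" "\<forall>x\<in>space M. \<bar>h x\<bar> \<le> B'"
    using assms by (auto simp: bmeas_def)
  have "\<bar>g x * h x\<bar> \<le> B * B'" if "x \<in> space M" for x
    using B that by (force simp: abs_mult intro!: mult_mono)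
  then show ?thesis
    using assms by (intro bmeasI[where B = "B * B'"]) (auto simp: bmeas_def)
qed

lemma bmeas_diff [simp, intro]: "bmeas M g \<Longrightarrow> bmeas M h \<Longrightarrow> bmeas M (\<lambda>x. g x - h x)"
  using bmeas_add[of M g "\<lambda>x. (-1) * h x"] bmeas_mult[of M "\<lambda>x. -1" h] by simp

lemma bmeas_divide [simp, intro]: "bmeas M g \<Longrightarrow> bmeas M (\<lambda>x. g x / c)"
  using bmeas_mult[of M g "\<lambda>x. 1/c"] by simp

lemma bmeas_power [simp, intro]: "bmeas M g \<Longrightarrow> bmeas M (\<lambda>x. g x ^ n)"
  by (induction n) auto

lemma bmeas_sum [simp, intro]: "(\<And>i. i \<in> I \<Longrightarrow> bmeas M (g i)) \<Longrightarrow> bmeas M (\<lambda>x. \<Sum>i\<in>I. g i x)"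
  by (induction I rule: infinite_finite_induct) auto

lemma bmeas_prod [simp, intro]: "(\<And>i. i \<in> I \<Longrightarrow> bmeas M (g i)) \<Longrightarrow> bmeas M (\<lambda>x. \<Prod>i\<in>I. g i x)"
  by (induction I rule: infinite_finite_induct) auto

lemma (in finite_measure) bmeas_integrable [simp, intro]: "bmeas M g \<Longrightarrow> integrable M g"
  unfolding bmeas_def using integrable_const_bound[of g] by (metis AE_I2 real_norm_def)

section \<open>Inequalities for even powers and moments\<close>

lemma even_power_tangent:
  fixes c y :: real
  assumes "even n"
  shows "c ^ n + n * c ^ (n - 1) * (y - c) \<le> y ^ n"
proof -
  have "(\<lambda>x. x ^ n) y - (\<lambda>x. x ^ n) c \<ge> (n * c ^ (n - 1)) * (y - c)"
    by (rule convex_on_imp_above_tangent[OF convex_power_even[OF assms]])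
      (auto intro!: derivative_eq_intros)
  then show ?thesis by (simp add: algebra_simps)
qed

lemma even_power_add_le:
  fixes u v :: real
  shows "(u + v) ^ (2 * m) \<le> 2 ^ (2 * m) * (u ^ (2 * m) + v ^ (2 * m))"
proof -
  define t where "t = max \<bar>u\<bar> \<bar>v\<bar>"
  have "(u + v) ^ (2 * m) = \<bar>u + v\<bar> ^ (2 * m)" by (simp add: power_even_abs)
  also have "\<dots> \<le> (2 * t) ^ (2 * m)"
    unfolding t_def by (intro power_mono) auto
  also have "\<dots> = 2 ^ (2 * m) * t ^ (2 * m)" by (simp add: power_mult_distrib)
  also have "t ^ (2 * m) \<le> u ^ (2 * m) + v ^ (2 * m)"
    by (cases "\<bar>u\<bar> \<le> \<bar>v\<bar>") (auto simp: t_def max_def power_even_abs zero_le_even_power)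
  finally show ?thesis by simp
qed

lemma (in prob_space) moment_mono:
  assumes "bmeas M Y"
  shows "expectation (\<lambda>x. Y x ^ 2) ^ m \<le> expectation (\<lambda>x. Y x ^ (2 * m))"
proof (cases "m = 0")
  case False
  define c where "c = expectation (\<lambda>x. Y x ^ 2)"
  have c0: "c \<ge> 0" unfolding c_def by (rule Bochner_Integration.integral_nonneg) auto
  \<comment> \<open>Tangent line of \<open>u ^ m\<close> at the mean \<open>c\<close>, on
    \<open>u \<ge> 0\<close> only since \<open>m\<close> may be odd. For \<open>c \<noteq> 0\<close>
    it is Bernoulli's inequality for \<open>u / c\<close>, scaled by \<open>c ^ m\<close>.\<close>
  have tan: "c ^ m + m * c ^ (m - 1) * (u - c) \<le> u ^ m" if "u \<ge> 0" for u
  proof (cases "c = 0")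
    case True
    then show ?thesis using False that by (cases "m = 1") (auto simp: power_0_left)
  next
    case c: False
    have "1 + m * (u / c - 1) \<le> (1 + (u / c - 1)) ^ m"
      using that c0 by (intro Bernoulli_inequality) auto
    then have "c ^ m * (1 + m * (u / c - 1)) \<le> c ^ m * (u / c) ^ m"
      using c0 by (intro mult_left_mono) auto
    also have "\<dots> = u ^ m" using c by (simp add: power_divide)
    also have "c ^ m * (1 + m * (u / c - 1)) = c ^ m + m * c ^ (m - 1) * (u - c)"
      using c False by (cases m) (auto simp: field_simps)
    finally show ?thesis .
  qed
  have "c ^ m = expectation (\<lambda>x. c ^ m + m * c ^ (m - 1) * (Y x ^ 2 - c))"
    using assms by (subst Bochner_Integration.integral_add) (auto simp: prob_space c_def)
  also have "\<dots> \<le> expectation (\<lambda>x. (Y x ^ 2) ^ m)"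
    using assms tan by (intro integral_mono) auto
  finally show ?thesis by (simp add: c_def power_mult)
qed (simp add: prob_space)

lemma (in prob_space) paley_zygmund:
  assumes Z: "bmeas M Z" "\<And>x. x \<in> space M \<Longrightarrow> Z x \<ge> 0" and t: "0 \<le> t" "t \<le> expectation Z"
  shows "(expectation Z - t)\<^sup>2 \<le> expectation (\<lambda>x. Z x ^ 2) * prob {x \<in> space M. Z x > t}"
proof -
  define E where "E = {x \<in> space M. Z x > t}"
  have [measurable]: "Z \<in> borel_measurable M" using Z bmeas_measurable by blast
  have E: "E \<in> sets M" unfolding E_def by measurable
  define V where "V = expectation (\<lambda>x. Z x ^ 2)"
  define p where "p = prob E"
  define d where "d = expectation Z - t"
  have bE: "bmeas M (indicator E :: _ \<Rightarrow> real)"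
    using E by (intro bmeasI[where B = 1]) (auto simp: indicator_def)
  \<comment> \<open>Pointwise bound to be integrated: on \<open>E\<close> it comes from
    \<open>(Z - l)\<^sup>2 \<ge> 0\<close>, off \<open>E\<close> from \<open>Z \<le> t\<close>.
    Optimising over \<open>l\<close> afterwards takes the place of the Cauchy-Schwarz
    inequality.\<close>
  have key: "2 * l * d \<le> V + l\<^sup>2 * p" if "l \<ge> 0" for l
  proof -
    have "expectation (\<lambda>x. 2 * l * Z x) \<le> expectation (\<lambda>x. Z x ^ 2 + l\<^sup>2 * indicator E x + 2 * l * t)"
    proof (rule integral_mono)
      fix x assume x: "x \<in> space M"
      show "2 * l * Z x \<le> (Z x)\<^sup>2 + l\<^sup>2 * indicator E x + 2 * l * t"
      proof (cases "x \<in> E")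
        case True
        have "0 \<le> (Z x - l)\<^sup>2" "0 \<le> l * t" using that t by auto
        then show ?thesis using True by (simp add: power2_diff algebra_simps)
      next
        case False
        then have "Z x \<le> t" using x by (auto simp: E_def)
        then have "l * Z x \<le> l * t" using that by (intro mult_left_mono) auto
        then have "2 * l * Z x \<le> (Z x)\<^sup>2 + 2 * l * t"
          using zero_le_power2[of "Z x"] by linarith
        moreover have "indicator E x = (0 :: real)" using False by simp
        ultimately show ?thesis using zero_le_power2[of "Z x"] by (simp only: mult_zero_right add_0_right)
      qed
    qed (use Z bE in auto)
    also have "\<dots> = V + l\<^sup>2 * p + 2 * l * t"
      using Z bE by (subst Bochner_Integration.integral_add, auto)+ (simp add: V_def p_def sets.Int_space_eq2[OF E] prob_space)
    finally show ?thesis by (simp add: d_def algebra_simps)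
  qed
  have V0: "V \<ge> 0" and p0: "p \<ge> 0" and d0: "d \<ge> 0"
    unfolding V_def p_def d_def using t by (auto intro!: Bochner_Integration.integral_nonneg)
  have "d\<^sup>2 \<le> V * p"
  proof (cases "p = 0")
    case True
    \<comment> \<open>With \<open>p = 0\<close> the bound \<open>key\<close> reads
      \<open>2 * l * d \<le> V\<close> for all \<open>l \<ge> 0\<close>, so \<open>d\<close> must
      vanish.\<close>
    have "d = 0"
    proof (rule ccontr)
      assume "d \<noteq> 0"
      then have "d > 0" using d0 by simp
      then have "2 * ((V + 1) / d) * d = 2 * (V + 1)" by simp
      then show False using key[of "(V + 1) / d"] V0 True \<open>d > 0\<close> by simp
    qed
    then show ?thesis using V0 p0 by simp
  next
    case False
    then have "p > 0" using p0 by simp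
    then show ?thesis using key[of "d / p"] d0 by (simp add: field_simps power2_eq_square)
  qed
  then show ?thesis by (simp add: d_def V_def p_def E_def)
qed

lemma (in prob_space) even_moment_markov:
  assumes "bmeas M X" "z > 0"
  shows "z ^ (2 * m) * prob {x \<in> space M. \<bar>X x\<bar> > z} \<le> expectation (\<lambda>x. X x ^ (2 * m))"
proof -
  have [measurable]: "X \<in> borel_measurable M" using assms bmeas_measurable by blast
  let ?E = "{x \<in> space M. \<bar>X x\<bar> > z}"
  have "z ^ (2 * m) * prob ?E = expectation (\<lambda>x. z ^ (2 * m) * indicator ?E x)"
    by simp
  also have "\<dots> \<le> expectation (\<lambda>x. X x ^ (2 * m))"
  proof (rule integral_mono)
    show "integrable M (\<lambda>x. z ^ (2 * m) * indicat_real ?E x)"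
      by (intro bmeas_integrable bmeas_mult bmeas_const, rule bmeasI[where B = 1]) (auto simp: indicator_def)
    show "z ^ (2 * m) * indicat_real ?E x \<le> X x ^ (2 * m)" for x
      using power_mono[of z "\<bar>X x\<bar>" "2 * m"] assms
      by (auto simp: indicator_def zero_le_even_power power_even_abs)
  qed (use assms in auto)
  finally show ?thesis .
qed

text \<open>The exponents run through \<open>2m = 2^(k+1)\<close>. At the last \<open>m\<close> for which \<open>z\<close> exceeds a fixed multiple of
  \<open>\<parallel>Y\<parallel>\<^sub>2\<^sub>m\<close>, Markov's inequality for \<open>X\<close> and the Paley-Zygmund inequality for \<open>Y^(2m)\<close> give
  bounds of the same exponential order.\<close>

lemma (in prob_space) tail_comparison:
  fixes K L :: real
  assumes X: "bmeas M X" and Y: "bmeas M Y" and K: "K \<ge> 2" and L: "L \<ge> 1"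
    and XY: "\<And>m. m \<ge> 1 \<Longrightarrow> expectation (\<lambda>x. X x ^ (2 * m)) \<le> L ^ (2 * m) * expectation (\<lambda>x. Y x ^ (2 * m))"
    and YY: "\<And>m. m \<ge> 1 \<Longrightarrow> expectation (\<lambda>x. Y x ^ (4 * m)) \<le> K ^ (4 * m) * expectation (\<lambda>x. Y x ^ (2 * m)) ^ 2"
    and z: "z > 0" and C: "C \<ge> 2 * L * K ^ 4"
  shows "prob {x \<in> space M. \<bar>X x\<bar> > z} \<le> C * prob {x \<in> space M. \<bar>Y x\<bar> > z / C}"
proof -
  define y where "y m = expectation (\<lambda>x. Y x ^ (2 * m))" for m
  \<comment> \<open>With this \<open>A\<close>, Markov's inequality at a good exponent yields
    \<open>(L / A) ^ (2 * m) = 1 / K ^ (4 * m)\<close>, the order of the lower bound in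
    \<open>PZ\<close>.\<close>
  define A where "A = L * K\<^sup>2"
  define P where "P = prob {x \<in> space M. \<bar>X x\<bar> > z}"
  have [measurable]: "X \<in> borel_measurable M" "Y \<in> borel_measurable M" 
    using X Y bmeas_measurable by blast+
  have y0: "y m \<ge> 0" for m unfolding y_def by (rule Bochner_Integration.integral_nonneg) (simp add: zero_le_even_power)
  have "0 < A" using K L by (simp add: A_def)
  have K4: "K ^ 4 \<ge> 1" "K ^ 2 \<ge> 1" using K by simp_all
  have C1: "2 * A * K \<le> C" "2 * K ^ 4 \<le> C" "0 < C"
  proof -
    have "L * K ^ 3 * 1 \<le> L * K ^ 3 * K" using K L by (intro mult_left_mono) auto
    then show "2 * A * K \<le> C" using C by (simp add: A_def power_numeral_reduce algebra_simps)
    have "1 * K ^ 4 \<le> L * K ^ 4" using K L by (intro mult_right_mono) auto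
    then show "2 * K ^ 4 \<le> C" using C by simp
    then show "0 < C" using K4 by simp
  qed
  \<comment> \<open>Paley-Zygmund for \<open>Y ^ (2 * m)\<close>: as
    \<open>4 \<le> 2 ^ (2 * m)\<close>, the threshold \<open>w ^ (2 * m)\<close> is at most a
    quarter of the mean, whence \<open>(3 / 4)\<^sup>2 = 9 / 16\<close>.\<close>
  have PZ: "9 / 16 \<le> K ^ (4 * m) * prob {x \<in> space M. \<bar>Y x\<bar> > w}"
    if m: "m \<ge> 1" and w: "0 < w" "(2 * w) ^ (2 * m) \<le> y m" and ypos: "y m > 0" for m w
  proof -
    have y2: "expectation (\<lambda>x. (Y x ^ (2 * m))\<^sup>2) \<le> K ^ (4 * m) * (y m)\<^sup>2"
      using YY[OF m] by (simp add: y_def flip: power_mult)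
    have "(2::real) ^ (2 * m) = 4 ^ m" by (simp add: power_mult)
    then have "4 \<le> (2::real) ^ (2 * m)" using m power_increasing[of 1 m "4::real"] by simp
    then have "4 * w ^ (2 * m) \<le> (2 * w) ^ (2 * m)"
      unfolding power_mult_distrib using w by (intro mult_right_mono) auto
    then have wy: "w ^ (2 * m) \<le> y m / 4" using w(2) by linarith
    let ?S = "{x \<in> space M. Y x ^ (2 * m) > w ^ (2 * m)}"
    have "(3 / 4 * y m)\<^sup>2 \<le> (y m - w ^ (2 * m))\<^sup>2"
      using wy ypos by (intro power_mono) auto
    also have "\<dots> \<le> expectation (\<lambda>x. (Y x ^ (2 * m))\<^sup>2) * prob ?S"
      unfolding y_def
    proof (rule paley_zygmund)
      show "w ^ (2 * m) \<le> expectation (\<lambda>x. Y x ^ (2 * m))"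
        using wy y0[of m] unfolding y_def by linarith
    qed (use Y w in \<open>auto simp: zero_le_even_power\<close>)
    also have "\<dots> \<le> K ^ (4 * m) * (y m)\<^sup>2 * prob ?S"
      using y2 by (intro mult_right_mono) auto
    finally have "9 / 16 \<le> K ^ (4 * m) * prob ?S"
      using ypos by (simp add: power2_eq_square field_simps)
    also have "?S = {x \<in> space M. \<bar>Y x\<bar> > w}"
    proof -
      have "w ^ (2 * m) < Y x ^ (2 * m) \<longleftrightarrow> w < \<bar>Y x\<bar>" for x
        using power_strict_mono[of w "\<bar>Y x\<bar>" "2 * m"] power_mono[of "\<bar>Y x\<bar>" w "2 * m"] w m
        by (auto simp: power_even_abs not_less) (metis not_le)
      then show ?thesis by simp
    qed
    finally show ?thesis .
  qed
  have mono: "prob {x \<in> space M. \<bar>Y x\<bar> > w} \<le> prob {x \<in> space M. \<bar>Y x\<bar> > z / C}" if "z / C \<le> w" for w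
    using that by (intro finite_measure_mono) auto
  define good where "good k \<longleftrightarrow> A ^ (2 * 2 ^ k) * y (2 ^ k) \<le> z ^ (2 * 2 ^ k)" for k :: nat
  have Pgood: "P \<le> 1 / K ^ (2 * (2 * 2 ^ k))" if "good k" for k
  proof -
    let ?m = "2 ^ k :: nat"
    have "A ^ (2 * ?m) * (z ^ (2 * ?m) * P) \<le> A ^ (2 * ?m) * (L ^ (2 * ?m) * y ?m)"
      using even_moment_markov[OF X z, of ?m] XY[of ?m] \<open>0 < A\<close>
      by (intro mult_left_mono) (auto simp: P_def y_def)
    also have "\<dots> = L ^ (2 * ?m) * (A ^ (2 * ?m) * y ?m)" by simp
    also have "\<dots> \<le> L ^ (2 * ?m) * z ^ (2 * ?m)"
      using that L unfolding good_def by (intro mult_left_mono) auto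
    finally have "z ^ (2 * ?m) * (A ^ (2 * ?m) * P) \<le> z ^ (2 * ?m) * L ^ (2 * ?m)"
      by (simp add: algebra_simps)
    then have "A ^ (2 * ?m) * P \<le> L ^ (2 * ?m)"
      using z by (subst (asm) mult_le_cancel_left_pos) auto
    then have "L ^ (2 * ?m) * (K ^ (2 * (2 * ?m)) * P) \<le> L ^ (2 * ?m) * 1"
      by (simp add: A_def power_mult_distrib mult.assoc flip: power_mult)
    then have "K ^ (2 * (2 * ?m)) * P \<le> 1"
      using L by (subst (asm) mult_le_cancel_left_pos) auto
    then show ?thesis using K by (simp add: field_simps)
  qed
  have *: "prob {x \<in> space M. \<bar>X x\<bar> > z} = P" by (simp add: P_def)
  show ?thesis unfolding *
  proof (cases "good 0")
    \<comment> \<open>Here \<open>z < A * sqrt (y 1)\<close>. The trivial bound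
      \<open>P \<le> 1\<close> suffices, since the second moment alone keeps the tail of
      \<open>Y\<close> above a constant.\<close>
    case False
    then have z2: "z\<^sup>2 < A\<^sup>2 * y 1" by (simp add: good_def)
    have ypos: "y 1 > 0" using z2 y0[of 1] \<open>0 < A\<close> by (cases "y 1 = 0") auto
    define w where "w = z / (2 * A)"
    have "(2 * w) ^ (2 * 1) \<le> y 1"
      using z2 \<open>0 < A\<close> by (simp add: w_def power_divide pos_divide_le_eq mult.commute)
    then have "9 / 16 \<le> K ^ 4 * prob {x \<in> space M. \<bar>Y x\<bar> > w}"
      using PZ[of 1 w] z \<open>0 < A\<close> ypos by (simp add: w_def)
    also have "\<dots> \<le> K ^ 4 * prob {x \<in> space M. \<bar>Y x\<bar> > z / C}"
    proof (intro mult_left_mono mono)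
      have "2 * A * 1 \<le> 2 * A * K" using K \<open>0 < A\<close> by (intro mult_left_mono) auto
      then have "2 * A \<le> C" using C1 by linarith
      then show "z / C \<le> w" unfolding w_def using C1 z \<open>0 < A\<close> by (intro divide_left_mono) auto
    qed auto
    finally have "1 \<le> 2 * K ^ 4 * prob {x \<in> space M. \<bar>Y x\<bar> > z / C}" by simp
    also have "\<dots> \<le> C * prob {x \<in> space M. \<bar>Y x\<bar> > z / C}"
      using C1 by (intro mult_right_mono) auto
    finally show "P \<le> C * prob {x \<in> space M. \<bar>Y x\<bar> > z / C}"
      using prob_le_1[of "{x \<in> space M. \<bar>X x\<bar> > z}"] unfolding P_def by linarith
  next
    case True
    show "P \<le> C * prob {x \<in> space M. \<bar>Y x\<bar> > z / C}"
    proof (cases "\<forall>k. good k")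
      case True
      \<comment> \<open>If every exponent is good, \<open>P\<close> lies below all terms of this
        null sequence.\<close>
      have lim: "(\<lambda>k. (1 / K) ^ (2 * (2 * 2 ^ k))) \<longlonglongrightarrow> 0"
      proof (rule tendsto_sandwich[OF _ _ tendsto_const])
        show "\<forall>\<^sub>F k in sequentially. 0 \<le> (1 / K) ^ (2 * (2 * 2 ^ k))" using K by auto
        have "k \<le> 2 * (2 * 2 ^ k)" for k :: nat
          using less_exp[of k] by linarith
        then show "\<forall>\<^sub>F k in sequentially. (1 / K) ^ (2 * (2 * 2 ^ k)) \<le> (1 / K) ^ k"
          using K by (intro always_eventually allI power_decreasing) auto
        show "(\<lambda>k. (1 / K) ^ k) \<longlonglongrightarrow> 0" using K by (intro LIMSEQ_realpow_zero) auto
      qed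
      have "P \<le> 0"
        using Pgood True by (intro LIMSEQ_le_const[OF lim]) (auto simp: power_one_over)
      also have "0 \<le> C * prob {x \<in> space M. \<bar>Y x\<bar> > z / C}" using C1 by simp
      finally show ?thesis .
    next
      case False
      define j where "j = (LEAST k. \<not> good k)"
      have nj: "\<not> good j" unfolding j_def using False by (metis LeastI)
      then have "j \<noteq> 0" using True by metis
      then obtain k where k: "j = Suc k" by (cases j) auto
      have gk: "good k" using not_less_Least[of k "\<lambda>k. \<not> good k"] k unfolding j_def by auto
      define m :: nat where "m = 2 ^ k"
      have m: "m \<ge> 1" by (simp add: m_def)
      \<comment> \<open>Exponent \<open>4 * m\<close> fails while \<open>2 * m\<close> is good.
        Through \<open>YY\<close> the failure descends to exponent \<open>2 * m\<close> at the cost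
        of a factor \<open>K\<close>, so \<open>z / (2 * A * K)\<close> is an admissible
        \<open>w\<close> in \<open>PZ\<close>.\<close>
      have e1: "z ^ (4 * m) < A ^ (4 * m) * y (2 * m)"
        using nj by (simp add: good_def k m_def not_le mult.assoc)
      also have "\<dots> \<le> A ^ (4 * m) * (K ^ (4 * m) * (y m)\<^sup>2)"
        using YY[OF m] \<open>0 < A\<close> by (intro mult_left_mono) (auto simp: y_def)
      also have "\<dots> = (((A * K) ^ (2 * m)) * y m)\<^sup>2"
        by (simp add: power_mult_distrib flip: power_mult)
      finally have sq: "(z ^ (2 * m))\<^sup>2 < (((A * K) ^ (2 * m)) * y m)\<^sup>2"
        by (simp flip: power_mult)
      have e2: "z ^ (2 * m) < (A * K) ^ (2 * m) * y m"
        by (rule power_less_imp_less_base[OF sq]) (use y0[of m] \<open>0 < A\<close> K in auto)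
      have ypos: "y m > 0" using e2 z y0[of m] by (cases "y m = 0") (auto simp: not_less)
      define w where "w = z / (2 * A * K)"
      have "(2 * w) ^ (2 * m) \<le> y m"
        using e2 \<open>0 < A\<close> K by (simp add: w_def power_divide pos_divide_le_eq mult.commute)
      then have "9 / 16 \<le> K ^ (4 * m) * prob {x \<in> space M. \<bar>Y x\<bar> > w}"
        using z \<open>0 < A\<close> K by (intro PZ[OF m _ _ ypos]) (auto simp: w_def)
      also have "\<dots> \<le> K ^ (4 * m) * prob {x \<in> space M. \<bar>Y x\<bar> > z / C}"
        unfolding w_def using C1 z \<open>0 < A\<close> K by (intro mult_left_mono mono divide_left_mono) auto
      finally have "9 / 16 * (1 / K ^ (4 * m)) \<le> prob {x \<in> space M. \<bar>Y x\<bar> > z / C}"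
        using K by (simp add: field_simps)
      then have "9 / 16 * P \<le> prob {x \<in> space M. \<bar>Y x\<bar> > z / C}"
        using Pgood[OF gk] by (simp add: m_def)
      moreover have "2 * prob {x \<in> space M. \<bar>Y x\<bar> > z / C} \<le> C * prob {x \<in> space M. \<bar>Y x\<bar> > z / C}"
        using C1 K4 by (intro mult_right_mono) auto
      ultimately show ?thesis using measure_nonneg[of M "{x \<in> space M. \<bar>Y x\<bar> > z / C}"] by linarith
    qed
  qed
qed

section \<open>Averages over signs and Rademacher sums\<close>

definition signs :: "'i set \<Rightarrow> ('i \<Rightarrow> real) set" where
  "signs I = PiE I (\<lambda>_. {-1, 1})"

definition sign_avg :: "'i set \<Rightarrow> (('i \<Rightarrow> real) \<Rightarrow> real) \<Rightarrow> real" where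
  "sign_avg I \<phi> = (\<Sum>e\<in>signs I. \<phi> e) / 2 ^ card I"

lemma signs_finite [simp]: "finite I \<Longrightarrow> finite (signs I)"
  by (simp add: signs_def finite_PiE)

lemma card_signs: "finite I \<Longrightarrow> card (signs I) = 2 ^ card I"
  by (simp add: signs_def card_PiE numeral_2_eq_2)

lemma signs_cases: "e \<in> signs I \<Longrightarrow> i \<in> I \<Longrightarrow> e i = -1 \<or> e i = 1"
  by (auto simp: signs_def PiE_iff)

lemma sum_PiE_insert:
  fixes g :: "('i \<Rightarrow> 'b) \<Rightarrow> 'c :: comm_monoid_add"
  assumes "k \<notin> I"
  shows "(\<Sum>e\<in>PiE (insert k I) B. g e) = (\<Sum>h\<in>PiE I B. \<Sum>y\<in>B k. g (h(k := y)))"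
proof -
  have "(\<Sum>e\<in>PiE (insert k I) B. g e) = (\<Sum>(y, h)\<in>B k \<times> PiE I B. g (h(k := y)))"
    unfolding PiE_insert_eq using assms
    by (subst sum.reindex[OF inj_combinator]) (auto simp: case_prod_unfold)
  also have "\<dots> = (\<Sum>y\<in>B k. \<Sum>h\<in>PiE I B. g (h(k := y)))"
    by (simp add: sum.cartesian_product)
  also have "\<dots> = (\<Sum>h\<in>PiE I B. \<Sum>y\<in>B k. g (h(k := y)))" by (rule sum.swap)
  finally show ?thesis .
qed

lemma sign_avg_empty [simp]: "sign_avg {} \<phi> = \<phi> (\<lambda>_. undefined)"
  by (simp add: sign_avg_def signs_def)

lemma sign_avg_insert:
  assumes "finite I" "k \<notin> I"
  shows "sign_avg (insert k I) \<phi> = (sign_avg I (\<lambda>e. \<phi> (e(k := 1))) + sign_avg I (\<lambda>e. \<phi> (e(k := -1)))) / 2"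
  using assms by (simp add: sign_avg_def signs_def sum_PiE_insert sum.distrib add_divide_distrib)

lemma sign_avg_mono:
  "(\<And>e. e \<in> signs I \<Longrightarrow> \<phi> e \<le> \<psi> e) \<Longrightarrow> sign_avg I \<phi> \<le> sign_avg I \<psi>"
  by (simp add: sign_avg_def divide_right_mono sum_mono)

lemma sign_avg_cong:
  "(\<And>e. e \<in> signs I \<Longrightarrow> \<phi> e = \<psi> e) \<Longrightarrow> sign_avg I \<phi> = sign_avg I \<psi>"
  by (simp add: sign_avg_def)

lemma sign_avg_const [simp]: "finite I \<Longrightarrow> sign_avg I (\<lambda>e. c) = c"
  by (simp add: sign_avg_def card_signs)

lemma sign_avg_add: "sign_avg I (\<lambda>e. \<phi> e + \<psi> e) = sign_avg I \<phi> + sign_avg I \<psi>"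
  by (simp add: sign_avg_def sum.distrib add_divide_distrib)

lemma sign_avg_cmult: "sign_avg I (\<lambda>e. c * \<phi> e) = c * sign_avg I \<phi>"
  by (simp add: sign_avg_def sum_distrib_left)

lemma sign_avg_divide: "sign_avg I (\<lambda>e. \<phi> e / c) = sign_avg I \<phi> / c"
  using sign_avg_cmult[of I "1 / c" \<phi>] by simp

lemma sign_avg_sum: "sign_avg I (\<lambda>e. \<Sum>j\<in>J. \<phi> j e) = (\<Sum>j\<in>J. sign_avg I (\<phi> j))"
  unfolding sign_avg_def by (subst sum.swap) (simp add: sum_divide_distrib)

text \<open>Independence of the signs: expanding the product of two-point sums lists every sign
  vector once.\<close>

lemma sign_avg_prod:
  assumes "finite I"
  shows "sign_avg I (\<lambda>e. \<Prod>i\<in>I. g i (e i)) = (\<Prod>i\<in>I. (g i 1 + g i (-1)) / 2)"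
proof -
  have "(\<Prod>i\<in>I. g i (-1) + g i 1) = (\<Prod>i\<in>I. \<Sum>y\<in>{-1, 1}. g i y)" by simp
  also have "\<dots> = (\<Sum>e\<in>signs I. \<Prod>i\<in>I. g i (e i))"
    unfolding signs_def using assms by (intro prod_sum_PiE) auto
  finally show ?thesis by (simp add: sign_avg_def prod_dividef add.commute)
qed

section \<open>Symmetry of Rademacher sums\<close>

definition rad_sum :: "'i set \<Rightarrow> ('i \<Rightarrow> real) \<Rightarrow> ('i \<Rightarrow> real) \<Rightarrow> real" where
  "rad_sum I a e = (\<Sum>i\<in>I. a i * e i)"

lemma rad_sum_empty [simp]: "rad_sum {} a e = 0"
  by (simp add: rad_sum_def)

lemma rad_sum_insert:
  assumes "finite I" "k \<notin> I"
  shows "rad_sum (insert k I) a (e(k := y)) = a k * y + rad_sum I a e"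
proof -
  have "(\<Sum>i\<in>I. a i * (e(k := y)) i) = (\<Sum>i\<in>I. a i * e i)"
    using assms by (intro sum.cong) auto
  then show ?thesis using assms by (simp add: rad_sum_def)
qed

lemma sign_avg_rad_sum_insert:
  assumes "finite I" "k \<notin> I"
  shows "sign_avg (insert k I) (\<lambda>e. \<phi> (rad_sum (insert k I) a e))
    = (sign_avg I (\<lambda>e. \<phi> (a k + rad_sum I a e)) + sign_avg I (\<lambda>e. \<phi> (- a k + rad_sum I a e))) / 2"
  using assms by (simp add: sign_avg_insert rad_sum_insert)

text \<open>The sum and its negative have the same distribution. In the induction
  \<open>\<phi>\<close> varies, so that it can absorb the shifts by \<open>a k\<close> and
  \<open>- a k\<close>.\<close>

lemma sign_avg_flip:
  assumes "finite I"
  shows "sign_avg I (\<lambda>e. \<phi> (- rad_sum I a e)) = sign_avg I (\<lambda>e. \<phi> (rad_sum I a e))"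
  using assms
proof (induction I arbitrary: \<phi> rule: finite_induct)
  case (insert k I)
  have "sign_avg (insert k I) (\<lambda>e. \<phi> (- rad_sum (insert k I) a e))
      = (sign_avg I (\<lambda>e. \<phi> (- a k + - rad_sum I a e)) + sign_avg I (\<lambda>e. \<phi> (a k + - rad_sum I a e))) / 2"
    using insert.hyps by (subst sign_avg_rad_sum_insert) (auto simp: algebra_simps)
  also have "\<dots> = (sign_avg I (\<lambda>e. \<phi> (- a k + rad_sum I a e)) + sign_avg I (\<lambda>e. \<phi> (a k + rad_sum I a e))) / 2"
    using insert.IH[of "\<lambda>u. \<phi> (- a k + u)"] insert.IH[of "\<lambda>u. \<phi> (a k + u)"] by simp
  also have "\<dots> = sign_avg (insert k I) (\<lambda>e. \<phi> (rad_sum (insert k I) a e))"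
    using insert.hyps by (simp add: sign_avg_rad_sum_insert)
  finally show ?case .
qed simp

text \<open>For an even function one sign can be frozen at 1. This matches the first Rademacher
  function, which is 1 on the open unit interval.\<close>

lemma sign_avg_even_insert:
  assumes "finite I" "k \<notin> I" and even: "\<And>u. \<phi> (- u) = \<phi> u"
  shows "sign_avg (insert k I) (\<lambda>e. \<phi> (rad_sum (insert k I) a e)) = sign_avg I (\<lambda>e. \<phi> (a k + rad_sum I a e))"
proof -
  have "sign_avg I (\<lambda>e. \<phi> (- a k + rad_sum I a e)) = sign_avg I (\<lambda>e. \<phi> (- a k + - rad_sum I a e))"
    using sign_avg_flip[OF assms(1), of "\<lambda>u. \<phi> (- a k + u)"] by simp
  also have "\<dots> = sign_avg I (\<lambda>e. \<phi> (a k + rad_sum I a e))"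
    using even[of "a k + _"] by simp
  finally show ?thesis using assms by (simp add: sign_avg_rad_sum_insert)
qed

section \<open>Even moments of Rademacher sums\<close>

lemma even_power_symmetric_sum:
  fixes y a :: real
  shows "((a + y) ^ (2 * m) + (- a + y) ^ (2 * m)) / 2 / fact (2 * m)
     = (\<Sum>j\<le>m. a ^ (2 * j) / fact (2 * j) * (y ^ (2 * (m - j)) / fact (2 * (m - j))))"
proof -
  let ?t = "\<lambda>j. a ^ j / fact j * (y ^ (2 * m - j) / fact (2 * m - j))"
  have "((a + y) ^ (2 * m) + (- a + y) ^ (2 * m)) / 2 / fact (2 * m)
      = (\<Sum>j\<le>2 * m. real (2 * m choose j) * ((a ^ j + (- a) ^ j) / 2) * y ^ (2 * m - j) / fact (2 * m))"
    unfolding binomial_ring sum.distrib[symmetric] sum_divide_distrib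
    by (rule sum.cong) (simp_all add: field_simps)
  also have "\<dots> = (\<Sum>j\<le>2 * m. if even j then ?t j else 0)"
  proof (rule sum.cong)
    fix j assume "j \<in> {..2 * m}"
    then show "real (2 * m choose j) * ((a ^ j + (- a) ^ j) / 2) * y ^ (2 * m - j) / fact (2 * m)
       = (if even j then ?t j else 0)"
      by (simp add: binomial_fact power_minus_odd)
  qed simp
  also have "\<dots> = (\<Sum>j\<in>{j. j \<le> 2 * m \<and> even j}. ?t j)"
    by (simp add: sum.If_cases Int_def)
  also have "\<dots> = (\<Sum>j\<le>m. ?t (2 * j))"
    by (rule sum.reindex_bij_witness[where i = "\<lambda>j. 2 * j" and j = "\<lambda>j. j div 2"]) (auto elim!: evenE)
  finally show ?thesis by (simp add: diff_mult_distrib2)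
qed

text \<open>Coefficient of \<open>t ^ (2 * m)\<close> in the moment generating function of the sum,
  which is the product of all \<open>cosh (a i * t)\<close>.\<close>

definition nmoment :: "'i set \<Rightarrow> ('i \<Rightarrow> real) \<Rightarrow> nat \<Rightarrow> real" where
  "nmoment I a m = sign_avg I (\<lambda>e. rad_sum I a e ^ (2 * m)) / fact (2 * m)"

text \<open>Multiplication of the generating function by the series of
  \<open>cosh (a k * t)\<close>.\<close>

lemma nmoment_insert:
  assumes "finite I" "k \<notin> I"
  shows "nmoment (insert k I) a m = (\<Sum>j\<le>m. a k ^ (2 * j) / fact (2 * j) * nmoment I a (m - j))"
proof -
  have "nmoment (insert k I) a m
     = sign_avg I (\<lambda>e. ((a k + rad_sum I a e) ^ (2 * m) + (- a k + rad_sum I a e) ^ (2 * m)) / 2 / fact (2 * m))"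
    unfolding nmoment_def using assms
    by (subst sign_avg_rad_sum_insert) (simp_all only: sign_avg_divide sign_avg_add not_False_eq_True)
  also have "\<dots> = (\<Sum>j\<le>m. a k ^ (2 * j) / fact (2 * j) *
      sign_avg I (\<lambda>e. rad_sum I a e ^ (2 * (m - j)) / fact (2 * (m - j))))"
    by (simp only: even_power_symmetric_sum sign_avg_sum sign_avg_cmult)
  finally show ?thesis
    by (simp add: nmoment_def sign_avg_divide)
qed

lemma nmoment_nonneg: "nmoment I a m \<ge> 0"
  unfolding nmoment_def sign_avg_def
  by (intro divide_nonneg_nonneg sum_nonneg) (auto simp: zero_le_even_power)

lemma fact_mult_le: "fact m * fact n \<le> (fact (m + n) :: real)"
proof -
  have "(fact m * fact n :: nat) \<le> fact (m + n)"
    using fact_fact_dvd_fact[of m n] by (intro dvd_imp_le) (auto simp: add.commute)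
  then show ?thesis by (metis of_nat_fact of_nat_le_iff of_nat_mult)
qed

text \<open>Each monomial of the left-hand side splits as a product of a monomial from either factor, and
  \<open>m! n! \<le> (m + n)!\<close>. The map \<open>j \<mapsto> (min j k, j - min j k)\<close> below is this splitting.\<close>

lemma nmoment_submult:
  assumes "finite I"
  shows "nmoment I a (k + l) \<le> nmoment I a k * nmoment I a l"
  using assms
proof (induction I arbitrary: k l rule: finite_induct)
  case empty
  then show ?case by (simp add: nmoment_def power_0_left)
next
  case (insert i I)
  define b where "b j = a i ^ (2 * j) / fact (2 * j)" for j
  have b0: "b j \<ge> 0" for j by (simp add: b_def zero_le_even_power)
  have bsub: "b (p + q) \<le> b p * b q" for p q
  proof -
    have "b (p + q) = a i ^ (2 * p + 2 * q) / fact (2 * p + 2 * q)" by (simp add: b_def distrib_left)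
    also have "\<dots> \<le> a i ^ (2 * p + 2 * q) / (fact (2 * p) * fact (2 * q))"
      by (intro divide_left_mono fact_mult_le) (auto simp: zero_le_even_power)
    finally show ?thesis by (simp add: b_def power_add)
  qed
  let ?g = "\<lambda>(p, q). (b p * nmoment I a (k - p)) * (b q * nmoment I a (l - q))"
  let ?s = "\<lambda>j. (min j k, j - min j k)"
  have "nmoment (insert i I) a (k + l) = (\<Sum>j\<le>k + l. b j * nmoment I a (k + l - j))"
    using insert.hyps by (simp add: nmoment_insert b_def)
  also have "\<dots> \<le> (\<Sum>j\<le>k + l. ?g (?s j))"
  proof (rule sum_mono)
    fix j assume j: "j \<in> {..k + l}"
    \<comment> \<open>Either \<open>q = 0\<close> or \<open>p = k\<close>; since
      \<open>j \<le> k + l\<close>, always \<open>p \<le> k\<close> and \<open>q \<le> l\<close>, so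
      the complementary exponent splits as well.\<close>
    define p q where "p = min j k" and "q = j - min j k"
    have pq: "j = p + q" "k + l - j = (k - p) + (l - q)" using j by (auto simp: p_def q_def)
    have "b j * nmoment I a (k + l - j) \<le> (b p * b q) * (nmoment I a (k - p) * nmoment I a (l - q))"
      unfolding pq(2) unfolding pq(1)
      by (intro mult_mono bsub insert.IH) (auto intro: b0 nmoment_nonneg mult_nonneg_nonneg)
    then show "b j * nmoment I a (k + l - j) \<le> ?g (?s j)"
      by (simp add: p_def q_def algebra_simps)
  qed
  also have "\<dots> = sum ?g (?s ` {..k + l})"
    by (subst sum.reindex) (auto simp: inj_on_def min_def split: if_splits)
  also have "\<dots> \<le> sum ?g ({..k} \<times> {..l})"
    by (rule sum_mono2) (auto intro!: mult_nonneg_nonneg b0 nmoment_nonneg)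
  also have "\<dots> = nmoment (insert i I) a k * nmoment (insert i I) a l"
    using insert.hyps by (simp add: nmoment_insert sum_product sum.cartesian_product b_def)
  finally show ?case .
qed

text \<open>Submultiplicativity with two equal parts costs a central binomial coefficient, at most
  \<open>2 ^ (4 * m)\<close>. Hence the constant 2 between the norms of order \<open>4 * m\<close>
  and \<open>2 * m\<close> does not depend on \<open>m\<close>.\<close>

lemma rademacher_hypercontractive:
  assumes "finite I"
  shows "sign_avg I (\<lambda>e. rad_sum I a e ^ (4 * m)) \<le> 2 ^ (4 * m) * sign_avg I (\<lambda>e. rad_sum I a e ^ (2 * m)) ^ 2"
proof -
  let ?E = "\<lambda>n. sign_avg I (\<lambda>e. rad_sum I a e ^ n)"
  have "?E (2 * (m + m)) / fact (2 * (m + m)) \<le> (?E (2 * m) / fact (2 * m)) * (?E (2 * m) / fact (2 * m))"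
    using nmoment_submult[OF assms, of a m m] by (simp only: nmoment_def)
  then have "?E (4 * m) / fact (4 * m) \<le> (?E (2 * m) / fact (2 * m))\<^sup>2"
    by (simp add: power2_eq_square)
  then have "?E (4 * m) \<le> (fact (4 * m) / (fact (2 * m))\<^sup>2) * (?E (2 * m))\<^sup>2"
    by (simp add: field_simps)
  also have "fact (4 * m) / (fact (2 * m))\<^sup>2 = real (4 * m choose (2 * m))"
    by (simp add: binomial_fact power2_eq_square)
  also have "real (4 * m choose (2 * m)) \<le> 2 ^ (4 * m)"
    using binomial_le_pow2[of "4 * m" "2 * m"] by (metis of_nat_le_iff of_nat_numeral of_nat_power)
  finally show ?thesis by (simp add: mult_right_mono)
qed

section \<open>Rademacher functions on the unit interval\<close>

lemma rademacher_double: "j \<ge> 1 \<Longrightarrow> rademacher j (2 * t) = rademacher (Suc j) t"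
  by (cases j) (auto simp: rademacher_def algebra_simps)

text \<open>From index 2 on, 1 is a period; the function of index 1 changes sign under this
  shift.\<close>

lemma rademacher_shift: 
  assumes "j \<ge> 2" 
  shows "rademacher j (t - 1) = rademacher j t"
proof -
  obtain i where i: "j = i + 2" using assms by (metis add.commute le_Suc_ex)
  have "sin (2 ^ (j - 1) * pi * (t - 1)) = sin (2 ^ (j - 1) * pi * t - 2 * real (2 ^ i) * pi)"
    by (simp add: i algebra_simps)
  also have "\<dots> = sin (2 ^ (j - 1) * pi * t)"
    by (simp only: sin_diff sin_2npi cos_2npi)
  finally show ?thesis by (simp add: rademacher_def)
qed

lemma rademacher_1: "0 < t \<Longrightarrow> t < 1 \<Longrightarrow> rademacher 1 t = 1"
  using sin_gt_zero[of "pi * t"] by (simp add: rademacher_def)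

lemma rademacher_2: 
  "0 < t \<Longrightarrow> t < 1/2 \<Longrightarrow> rademacher 2 t = 1"
  "1/2 < t \<Longrightarrow> t < 1 \<Longrightarrow> rademacher 2 t = -1"
proof -
  assume "0 < t" "t < 1/2"
  then show "rademacher 2 t = 1" using rademacher_double[of 1 t] rademacher_1[of "2 * t"] 
    by (simp add: numeral_2_eq_2)
next
  assume t: "1/2 < t" "t < 1"
  have "sin (2 * pi * t) = - sin (2 * pi * t - pi)" by (simp add: sin_diff)
  moreover have "sin (pi * (2 * t - 1)) > 0" using t by (intro sin_gt_zero) (auto simp: algebra_simps)
  ultimately have "sin (2 * pi * t) < 0" by (simp add: algebra_simps)
  then show "rademacher 2 t = -1" by (simp add: rademacher_def)
qed

text \<open>Induction by halving the interval: \<open>rademacher 2\<close> is 1 on the left half and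
  -1 on the right, and doubling \<open>t\<close> lowers all later indices by one. The constant
  \<open>c\<close> collects the terms already fixed; the numbering starts at the first function that
  takes both signs.\<close>

lemma rademacher_has_integral_aux:
  "((\<lambda>t. \<phi> (c + (\<Sum>i\<in>{k..<k + d}. b i * rademacher (i + 2 - k) t)))
     has_integral sign_avg {k..<k + d} (\<lambda>e. \<phi> (c + rad_sum {k..<k + d} b e))) {0..1}"
proof (induction d arbitrary: k c)
  case 0
  show ?case using has_integral_const_real[of "\<phi> c" 0 1] by simp
next
  case (Suc d)
  let ?I = "{Suc k..<Suc k + d}"
  have I: "{k..<k + Suc d} = insert k ?I" "k \<notin> ?I" by auto
  define g where "g c t = \<phi> (c + (\<Sum>i\<in>?I. b i * rademacher (i + 2 - Suc k) t))" for c t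
  define v where "v c = sign_avg ?I (\<lambda>e. \<phi> (c + rad_sum ?I b e))" for c
  define h where "h t = \<phi> (c + (\<Sum>i\<in>insert k ?I. b i * rademacher (i + 2 - k) t))" for t
  have g: "(g c has_integral v c) {0..1}" for c
    unfolding g_def v_def by (rule Suc.IH)
  have hg: "h t = g (c + b k * rademacher 2 t) (2 * t)" for t
  proof -
    have "rademacher (i + 2 - Suc k) (2 * t) = rademacher (i + 2 - k) t" if "i \<in> ?I" for i
      using that rademacher_double[of "i + 2 - Suc k" t] by (simp add: Suc_diff_le)
    then show ?thesis using I(2) by (simp add: h_def g_def add.assoc)
  qed
  \<comment> \<open>Doubling sends the right half to [1, 2]; periodicity brings it back to the unit
    interval.\<close>
  have gs: "g c (t - 1) = g c t" for c t
  proof -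
    have "rademacher (i + 2 - Suc k) (t - 1) = rademacher (i + 2 - Suc k) t" if "i \<in> ?I" for i
      using that by (intro rademacher_shift) auto
    then show ?thesis by (simp add: g_def)
  qed
  have "((\<lambda>t. g (c + b k) (2 * t)) has_integral v (c + b k) / 2) {0..1/2}"
    using has_integral_affinity'[of "g (c + b k)" "v (c + b k)" 0 1 2 0] g by simp
  then have 1: "(h has_integral v (c + b k) / 2) {0..1/2}"
    by (rule has_integral_spike_finite[where S = "{0, 1/2}", rotated 2]) (auto simp: hg rademacher_2(1))
  have "((\<lambda>t. g (c - b k) (2 * t + - 1)) has_integral v (c - b k) / 2) {1/2..1}"
    using has_integral_affinity'[of "g (c - b k)" "v (c - b k)" 0 1 2 "-1"] g by simp
  then have "((\<lambda>t. g (c - b k) (2 * t)) has_integral v (c - b k) / 2) {1/2..1}"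
    using gs by simp
  then have 2: "(h has_integral v (c - b k) / 2) {1/2..1}"
    by (rule has_integral_spike_finite[where S = "{1/2, 1}", rotated 2]) (auto simp: hg rademacher_2(2))
  have "(h has_integral v (c + b k) / 2 + v (c - b k) / 2) {0..1}"
    by (rule has_integral_combine[OF _ _ 1 2]) auto
  also have "v (c + b k) / 2 + v (c - b k) / 2
      = sign_avg (insert k ?I) (\<lambda>e. \<phi> (c + rad_sum (insert k ?I) b e))"
    using I(2) sign_avg_rad_sum_insert[of ?I k "\<lambda>u. \<phi> (c + u)" b]
    by (simp add: v_def add_divide_distrib algebra_simps)
  finally show ?case unfolding I(1) h_def .
qed

text \<open>Since \<open>r\<^sub>1 = 1\<close> almost everywhere, the sum itself is not distributed as a sum of \<open>s\<close> independent signs,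
  but by symmetry its modulus is.\<close>

lemma rademacher_has_integral:
  assumes "s \<ge> 1" and even: "\<And>u. \<phi> (- u) = \<phi> u"
  shows "((\<lambda>t. \<phi> (\<Sum>i=1..s. a i * rademacher i t)) has_integral
     sign_avg {1..s} (\<lambda>e. \<phi> (rad_sum {1..s} a e))) {0..1}"
proof -
  define d where "d = s - 1"
  let ?I = "{2..<2 + d}"
  have I: "{1..s} = insert 1 ?I" "1 \<notin> ?I" using assms by (auto simp: d_def)
  have "((\<lambda>t. \<phi> (a 1 + (\<Sum>i\<in>?I. a i * rademacher (i + 2 - 2) t)))
     has_integral sign_avg ?I (\<lambda>e. \<phi> (a 1 + rad_sum ?I a e))) {0..1}"
    by (rule rademacher_has_integral_aux)
  moreover have "sign_avg ?I (\<lambda>e. \<phi> (a 1 + rad_sum ?I a e)) = sign_avg {1..s} (\<lambda>e. \<phi> (rad_sum {1..s} a e))"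
    unfolding I(1) using I(2) even by (simp add: sign_avg_even_insert)
  ultimately have "((\<lambda>t. \<phi> (a 1 + (\<Sum>i\<in>?I. a i * rademacher i t)))
     has_integral sign_avg {1..s} (\<lambda>e. \<phi> (rad_sum {1..s} a e))) {0..1}"
    by simp
  then show ?thesis
    unfolding I(1) using I(2) rademacher_1
    by (elim has_integral_spike_finite[where S = "{0, 1}", rotated 2]) auto
qed

section \<open>Riesz products\<close>

locale bounded_orthonormal = prob_space M for M :: "'a measure" +
  fixes I :: "'i set" and g :: "'i \<Rightarrow> 'a \<Rightarrow> real" and D :: real
  assumes finite_I: "finite I" and I_nonempty: "I \<noteq> {}"
    and measurable_g: "\<And>i. i \<in> I \<Longrightarrow> g i \<in> borel_measurable M"
    and orthonormal: "\<And>i j. i \<in> I \<Longrightarrow> j \<in> I \<Longrightarrow> expectation (\<lambda>x. g i x * g j x) = (if i = j then 1 else 0)"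
    and bounded: "\<And>i x. i \<in> I \<Longrightarrow> x \<in> space M \<Longrightarrow> \<bar>g i x\<bar> \<le> D"
begin

lemma bmeas_g [simp, intro]: "i \<in> I \<Longrightarrow> bmeas M (g i)"
  using measurable_g bounded by (rule bmeasI)

text \<open>Normalisation forces it: \<open>(g i)\<^sup>2\<close> has mean 1 and is at most
  \<open>D\<^sup>2\<close>.\<close>

lemma D_ge_1: "D \<ge> 1"
proof -
  obtain i where i: "i \<in> I" using I_nonempty by blast
  obtain x where "x \<in> space M" using not_empty by blast
  then have D0: "D \<ge> 0" using bounded[OF i] abs_ge_zero order_trans by blast
  have "1 = expectation (\<lambda>x. g i x * g i x)" using orthonormal[OF i i] by simp
  also have "\<dots> \<le> expectation (\<lambda>x. D * D)"
  proof (rule integral_mono)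
    fix x assume "x \<in> space M"
    then have "\<bar>g i x\<bar> * \<bar>g i x\<bar> \<le> D * D"
      using bounded[OF i] by (intro mult_mono) (auto simp: D0)
    then show "g i x * g i x \<le> D * D" by (simp flip: abs_mult)
  qed (use i in auto)
  finally have "1\<^sup>2 \<le> D\<^sup>2" by (simp add: prob_space power2_eq_square)
  then show ?thesis using D0 by (rule power2_le_imp_le)
qed

lemma expectation_square_sum:
  assumes "B \<subseteq> I"
  shows "expectation (\<lambda>x. (\<Sum>i\<in>B. c i * g i x)\<^sup>2) = (\<Sum>i\<in>B. (c i)\<^sup>2)"
proof -
  have fin: "finite B" using assms finite_I finite_subset by blast
  have "expectation (\<lambda>x. (\<Sum>i\<in>B. c i * g i x)\<^sup>2)
      = expectation (\<lambda>x. \<Sum>i\<in>B. \<Sum>j\<in>B. c i * c j * (g i x * g j x))"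
    by (simp add: power2_eq_square sum_product algebra_simps)
  also have "\<dots> = (\<Sum>i\<in>B. \<Sum>j\<in>B. c i * c j * expectation (\<lambda>x. g i x * g j x))"
    using assms by (simp add: Bochner_Integration.integral_sum subset_iff)
  also have "\<dots> = (\<Sum>i\<in>B. \<Sum>j\<in>B. if i = j then c i * c j else 0)"
    using assms orthonormal by (intro sum.cong refl) (auto simp: subset_iff)
  finally show ?thesis using fin by (simp add: power2_eq_square)
qed

lemma bessel:
  assumes B: "B \<subseteq> I" and h: "bmeas M h"
  shows "(\<Sum>i\<in>B. (expectation (\<lambda>x. h x * g i x))\<^sup>2) \<le> expectation (\<lambda>x. (h x)\<^sup>2)"
proof -
  define c where "c i = expectation (\<lambda>x. h x * g i x)" for i
  let ?S = "\<lambda>x. \<Sum>i\<in>B. c i * g i x"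
  have bS: "bmeas M ?S" using B by (intro bmeas_sum bmeas_mult bmeas_const bmeas_g) auto
  have hS: "expectation (\<lambda>x. h x * ?S x) = (\<Sum>i\<in>B. (c i)\<^sup>2)"
  proof -
    have "expectation (\<lambda>x. h x * ?S x) = expectation (\<lambda>x. \<Sum>i\<in>B. c i * (h x * g i x))"
      by (simp add: sum_distrib_left algebra_simps)
    also have "\<dots> = (\<Sum>i\<in>B. c i * c i)"
      using B h by (simp add: Bochner_Integration.integral_sum subset_iff c_def)
    finally show ?thesis by (simp add: power2_eq_square)
  qed
  have "0 \<le> expectation (\<lambda>x. (h x - ?S x)\<^sup>2)" by (rule Bochner_Integration.integral_nonneg) simp
  also have "\<dots> = expectation (\<lambda>x. ((h x)\<^sup>2 + (?S x)\<^sup>2) - 2 * (h x * ?S x))"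
    by (simp add: power2_diff algebra_simps)
  also have "\<dots> = (expectation (\<lambda>x. (h x)\<^sup>2) + expectation (\<lambda>x. (?S x)\<^sup>2)) - 2 * expectation (\<lambda>x. h x * ?S x)"
    using h bS by (subst Bochner_Integration.integral_diff Bochner_Integration.integral_add integral_mult_right_zero, auto)+
  also have "\<dots> = expectation (\<lambda>x. (h x)\<^sup>2) - (\<Sum>i\<in>B. (c i)\<^sup>2)"
    unfolding hS expectation_square_sum[OF B] by simp
  finally show ?thesis by (simp add: c_def)
qed

end

section \<open>Riesz products and their sign averages\<close>

definition riesz :: "real \<Rightarrow> ('i \<Rightarrow> 'a \<Rightarrow> real) \<Rightarrow> 'i set \<Rightarrow> ('i \<Rightarrow> real) \<Rightarrow> 'a \<Rightarrow> real" where
  "riesz D g T e x = (\<Prod>i\<in>T. 1 + e i * g i x / D)"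

context bounded_orthonormal
begin

lemma riesz_factor_bounds:
  assumes "e \<in> signs I" "i \<in> I" "x \<in> space M"
  shows "0 \<le> 1 + e i * g i x / D" "1 + e i * g i x / D \<le> 2"
proof -
  have "\<bar>e i\<bar> = 1" using signs_cases[OF assms(1,2)] by auto
  then have "\<bar>e i * g i x / D\<bar> \<le> 1"
    using bounded[OF assms(2,3)] D_ge_1 by (simp add: abs_mult)
  then show "0 \<le> 1 + e i * g i x / D" "1 + e i * g i x / D \<le> 2" by linarith+
qed

lemma riesz_nonneg: "e \<in> signs I \<Longrightarrow> T \<subseteq> I \<Longrightarrow> x \<in> space M \<Longrightarrow> 0 \<le> riesz D g T e x"
  unfolding riesz_def by (intro prod_nonneg) (auto intro: riesz_factor_bounds)

lemma riesz_le:
  assumes "e \<in> signs I" "T \<subseteq> I" "x \<in> space M"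
  shows "riesz D g T e x \<le> 2 ^ card I"
proof -
  have "riesz D g T e x \<le> (\<Prod>i\<in>T. 2)"
    unfolding riesz_def using assms by (intro prod_mono conjI riesz_factor_bounds) auto
  also have "\<dots> \<le> 2 ^ card I"
    using card_mono[OF finite_I assms(2)] by (simp add: power_increasing)
  finally show ?thesis .
qed

lemma bmeas_riesz [simp, intro]: "T \<subseteq> I \<Longrightarrow> bmeas M (riesz D g T e)"
  unfolding riesz_def by (intro bmeas_prod bmeas_add bmeas_divide bmeas_mult bmeas_const) auto

lemma expectation_sign_avg:
  assumes "\<And>e. e \<in> signs I \<Longrightarrow> bmeas M (\<phi> e)"
  shows "expectation (\<lambda>x. sign_avg I (\<lambda>e. \<phi> e x)) = sign_avg I (\<lambda>e. expectation (\<phi> e))"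
  unfolding sign_avg_def using assms
  by (subst Bochner_Integration.integral_divide_zero) (simp add: Bochner_Integration.integral_sum)

text \<open>Together with \<open>riesz_nonneg\<close>: for fixed \<open>x\<close>, the values
  \<open>riesz D g I e x / 2 ^ card I\<close> form a probability distribution on the sign vectors
  \<open>e\<close>.\<close>

lemma sign_avg_riesz: "sign_avg I (\<lambda>e. riesz D g I e x) = 1"
  unfolding riesz_def using sign_avg_prod[OF finite_I, of "\<lambda>i y. 1 + y * g i x / D"] by simp

text \<open>Folded into the factor with index \<open>j\<close>, the extra sign makes that factor
  average to \<open>g j x / D\<close>; the others average to 1.\<close>

lemma sign_avg_riesz_coeff:
  assumes "j \<in> I"
  shows "sign_avg I (\<lambda>e. riesz D g I e x * e j) = g j x / D"
proof -
  let ?h = "\<lambda>i y. (1 + y * g i x / D) * (if i = j then y else 1)"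
  have "sign_avg I (\<lambda>e. riesz D g I e x * e j) = sign_avg I (\<lambda>e. \<Prod>i\<in>I. ?h i (e i))"
    using assms finite_I by (simp add: riesz_def prod.distrib)
  also have "\<dots> = (\<Prod>i\<in>I. (?h i 1 + ?h i (-1)) / 2)" by (rule sign_avg_prod[OF finite_I])
  also have "\<dots> = (\<Prod>i\<in>I. if i = j then g i x / D else 1)"
    by (intro prod.cong) auto
  finally show ?thesis using assms finite_I by simp
qed

lemma sign_avg_riesz_rad_sum:
  "sign_avg I (\<lambda>e. riesz D g I e x * rad_sum I a e) = (\<Sum>i\<in>I. a i * g i x) / D"
proof -
  have "sign_avg I (\<lambda>e. riesz D g I e x * rad_sum I a e)
      = sign_avg I (\<lambda>e. \<Sum>i\<in>I. a i * (riesz D g I e x * e i))"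
    by (simp add: rad_sum_def sum_distrib_left algebra_simps)
  also have "\<dots> = (\<Sum>i\<in>I. a i * (g i x / D))"
    by (simp add: sign_avg_sum sign_avg_cmult sign_avg_riesz_coeff)
  finally show ?thesis by (simp add: sum_divide_distrib)
qed

lemma riesz_insert:
  assumes "k \<notin> T" "finite T"
  shows "riesz D g (insert k T) e x = riesz D g T e x + e k / D * (riesz D g T e x * g k x)"
  using assms by (simp add: riesz_def algebra_simps)

text \<open>Factors are multiplied in one at a time; each changes the integral by
  \<open>e k / D\<close> times a small integral, hence by at most \<open>\<eta>\<close>. The uses
  are \<open>w = 1\<close> with \<open>J = {}\<close>, and \<open>w = (g j)\<^sup>2\<close> with
  \<open>J = {j}\<close>.\<close>

lemma riesz_expectation:
  assumes e: "e \<in> signs I" and w: "bmeas M w" and T: "T \<subseteq> I - J"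
    and small: "\<And>S k. S \<subseteq> I - J \<Longrightarrow> k \<in> I - J - S \<Longrightarrow> \<bar>expectation (\<lambda>x. w x * riesz D g S e x * g k x)\<bar> \<le> \<eta>"
  shows "\<bar>expectation (\<lambda>x. w x * riesz D g T e x) - expectation w\<bar> \<le> real (card T) * \<eta>"
proof -
  have "finite T" using T finite_I by (meson Diff_subset finite_subset)
  then show ?thesis using T
  proof (induction T rule: finite_induct)
    case empty
    then show ?case by (simp add: riesz_def)
  next
    case (insert k T)
    let ?E = "expectation (\<lambda>x. w x * riesz D g T e x * g k x)"
    have k: "k \<in> I" "T \<subseteq> I" using insert.prems by auto
    have "expectation (\<lambda>x. w x * riesz D g (insert k T) e x)
        = expectation (\<lambda>x. w x * riesz D g T e x + e k / D * (w x * riesz D g T e x * g k x))"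
      using insert.hyps by (simp add: riesz_insert algebra_simps)
    also have "\<dots> = expectation (\<lambda>x. w x * riesz D g T e x) + e k / D * ?E"
      using w k by (subst Bochner_Integration.integral_add) auto
    finally have *: "expectation (\<lambda>x. w x * riesz D g (insert k T) e x)
       = expectation (\<lambda>x. w x * riesz D g T e x) + e k / D * ?E" .
    have "\<bar>e k / D * ?E\<bar> = \<bar>?E\<bar> / D"
      using signs_cases[OF e k(1)] D_ge_1 by (auto simp: abs_mult)
    also have "\<dots> \<le> \<bar>?E\<bar>" using D_ge_1 by (simp add: divide_le_eq mult_le_cancel_left1)
    also have "\<dots> \<le> \<eta>" using insert by (intro small) auto
    finally have "\<bar>e k / D * ?E\<bar> \<le> \<eta>" .
    moreover have "\<bar>expectation (\<lambda>x. w x * riesz D g T e x) - expectation w\<bar> \<le> real (card T) * \<eta>"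
      using insert by auto
    moreover have "real (card (insert k T)) * \<eta> = real (card T) * \<eta> + \<eta>"
      using insert.hyps by (simp add: algebra_simps)
    ultimately show ?case unfolding * by linarith
  qed
qed

end

text \<open>The two families of small integrals control the mass and the coefficients of a Riesz
  product. The square in \<open>\<eta>_le\<close> pays for \<open>card I\<close> coefficients, each
  with error at most \<open>2 * D * card I * \<eta>\<close>.\<close>

locale almost_independent = bounded_orthonormal +
  fixes \<eta> K :: real
  assumes small1: "\<And>e S k. e \<in> signs I \<Longrightarrow> S \<subseteq> I \<Longrightarrow> k \<in> I - S \<Longrightarrow>
      \<bar>expectation (\<lambda>x. riesz D g S e x * g k x)\<bar> \<le> \<eta>"
    and small2: "\<And>e S j k. e \<in> signs I \<Longrightarrow> j \<in> I \<Longrightarrow> S \<subseteq> I - {j} \<Longrightarrow> k \<in> I - {j} - S \<Longrightarrow>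
      \<bar>expectation (\<lambda>x. (g j x)\<^sup>2 * riesz D g S e x * g k x)\<bar> \<le> \<eta>"
    and \<eta>_nonneg: "\<eta> \<ge> 0" and \<eta>_le: "(real (card I))\<^sup>2 * \<eta> \<le> D\<^sup>2 * K"
begin

section \<open>Moment comparison for almost independent systems\<close>

definition "Q = 1 + D\<^sup>2 * K"

lemma card_ge_1: "real (card I) \<ge> 1"
  using finite_I I_nonempty by (simp add: Suc_le_eq card_gt_0_iff)

lemma card_\<eta>_le: "card I * \<eta> \<le> D\<^sup>2 * K"
proof -
  have "card I * 1 * \<eta> \<le> card I * real (card I) * \<eta>"
    using card_ge_1 \<eta>_nonneg by (intro mult_right_mono mult_left_mono) auto
  then show ?thesis using \<eta>_le by (simp add: power2_eq_square)
qed

lemma D2K_nonneg: "D\<^sup>2 * K \<ge> 0"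
  using \<eta>_le \<eta>_nonneg by (meson mult_nonneg_nonneg order_trans zero_le_power2)

lemma K_nonneg: "K \<ge> 0"
  using D2K_nonneg D_ge_1 by (simp add: zero_le_mult_iff)

lemma Q_ge_1: "Q \<ge> 1"
  using D2K_nonneg by (simp add: Q_def)

lemma riesz_mass:
  assumes "e \<in> signs I"
  shows "expectation (riesz D g I e) \<le> Q"
proof -
  have "\<bar>expectation (\<lambda>x. 1 * riesz D g I e x) - expectation (\<lambda>x. 1)\<bar> \<le> card I * \<eta>"
    using riesz_expectation[OF assms, of "\<lambda>_. 1" I "{}" \<eta>] small1[OF assms] by simp
  then show ?thesis using card_\<eta>_le by (simp add: Q_def prob_space)
qed

text \<open>Splitting off the factor with index \<open>j\<close> leaves \<open>D\<close> times an
  integral bounded by \<open>small1\<close>, plus \<open>e j\<close> times the integral of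
  \<open>(g j)\<^sup>2\<close> against the other factors, which \<open>small2\<close> keeps close to
  1.\<close>

lemma riesz_coeff:
  assumes e: "e \<in> signs I" and j: "j \<in> I"
  shows "\<bar>D * expectation (\<lambda>x. riesz D g I e x * g j x) - e j\<bar> \<le> 2 * D * real (card I) * \<eta>"
proof -
  let ?J = "I - {j}"
  let ?A = "expectation (\<lambda>x. riesz D g ?J e x * g j x)"
  let ?B = "expectation (\<lambda>x. (g j x)\<^sup>2 * riesz D g ?J e x)"
  have I: "I = insert j ?J" using j by auto
  have "riesz D g I e x * g j x = riesz D g ?J e x * g j x + e j / D * ((g j x)\<^sup>2 * riesz D g ?J e x)" for x
    using riesz_insert[of j ?J e x] finite_I I by (simp add: algebra_simps power2_eq_square)
  then have "expectation (\<lambda>x. riesz D g I e x * g j x) =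
      expectation (\<lambda>x. riesz D g ?J e x * g j x + e j / D * ((g j x)\<^sup>2 * riesz D g ?J e x))" by simp
  also have "\<dots> = ?A + e j / D * ?B"
    using j by (subst Bochner_Integration.integral_add) auto
  finally have "D * expectation (\<lambda>x. riesz D g I e x * g j x) - e j = D * ?A + e j * (?B - 1)"
    using D_ge_1 by (simp add: field_simps)
  moreover have "\<bar>D * ?A\<bar> \<le> D * \<eta>"
    using D_ge_1 small1[OF e, of ?J j] j by (simp add: abs_mult)
  moreover have "\<bar>e j * (?B - 1)\<bar> \<le> card I * \<eta>"
  proof -
    have "expectation (\<lambda>x. (g j x)\<^sup>2) = 1" using orthonormal[OF j j] by (simp add: power2_eq_square)
    then have "\<bar>?B - 1\<bar> \<le> card ?J * \<eta>"
      using riesz_expectation[OF e, of "\<lambda>x. (g j x)\<^sup>2" ?J "{j}" \<eta>] small2[OF e j] j by auto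
    also have "\<dots> \<le> card I * \<eta>"
      using card_mono[OF finite_I, of ?J] \<eta>_nonneg by (intro mult_right_mono) auto
    finally show ?thesis using signs_cases[OF e j] by (auto simp: abs_mult)
  qed
  moreover have "D * \<eta> \<le> D * real (card I) * \<eta>"
    using card_ge_1 D_ge_1 \<eta>_nonneg by (intro mult_right_mono) auto
  moreover have "1 * (card I * \<eta>) \<le> D * (card I * \<eta>)"
    using D_ge_1 \<eta>_nonneg by (intro mult_right_mono) auto
  ultimately show ?thesis by (simp add: mult.assoc)
qed

text \<open>Pointwise Jensen: \<open>?F x / D\<close> is the mean of \<open>rad_sum I a e\<close>
  under the sign distribution given by the Riesz products at \<open>x\<close>. Integrating over
  \<open>x\<close> leaves their masses, each at most \<open>Q\<close>.\<close>

lemma moment_upper: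
  assumes "m \<ge> 1"
  shows "expectation (\<lambda>x. (\<Sum>i\<in>I. a i * g i x) ^ (2 * m))
    \<le> (D * Q) ^ (2 * m) * sign_avg I (\<lambda>e. rad_sum I a e ^ (2 * m))"
proof -
  let ?F = "\<lambda>x. \<Sum>i\<in>I. a i * g i x"
  let ?R = "rad_sum I a"
  let ?P = "riesz D g I"
  let ?n = "2 * m"
  have D0: "D > 0" using D_ge_1 by simp
  have bF: "bmeas M ?F" by auto
  have pt: "(?F x / D) ^ ?n \<le> sign_avg I (\<lambda>e. ?P e x * ?R e ^ ?n)" if x: "x \<in> space M" for x
  proof -
    let ?c = "?F x / D"
    have "?c ^ ?n = (?c ^ ?n - ?n * ?c ^ (?n - 1) * ?c) * sign_avg I (\<lambda>e. ?P e x)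
        + ?n * ?c ^ (?n - 1) * sign_avg I (\<lambda>e. ?P e x * ?R e)"
      unfolding sign_avg_riesz sign_avg_riesz_rad_sum by simp
    also have "\<dots> = sign_avg I (\<lambda>e. ?P e x * (?c ^ ?n + ?n * ?c ^ (?n - 1) * (?R e - ?c)))"
      unfolding sign_avg_cmult[symmetric] sign_avg_add[symmetric]
      by (rule sign_avg_cong) (simp add: algebra_simps)
    also have "\<dots> \<le> sign_avg I (\<lambda>e. ?P e x * ?R e ^ ?n)"
      using x by (intro sign_avg_mono mult_left_mono even_power_tangent riesz_nonneg) auto
    finally show ?thesis .
  qed
  have "expectation (\<lambda>x. (?F x / D) ^ ?n) \<le> expectation (\<lambda>x. sign_avg I (\<lambda>e. ?P e x * ?R e ^ ?n))"
  proof (rule integral_mono)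
    show "integrable M (\<lambda>x. sign_avg I (\<lambda>e. ?P e x * ?R e ^ ?n))"
      unfolding sign_avg_def by (intro bmeas_integrable bmeas_divide bmeas_sum bmeas_mult) auto
  qed (use pt bF in auto)
  also have "\<dots> = sign_avg I (\<lambda>e. expectation (?P e) * ?R e ^ ?n)"
    by (subst expectation_sign_avg) auto
  also have "\<dots> \<le> sign_avg I (\<lambda>e. Q * ?R e ^ ?n)"
    by (intro sign_avg_mono mult_right_mono riesz_mass) (auto simp: zero_le_even_power)
  also have "\<dots> = Q * sign_avg I (\<lambda>e. ?R e ^ ?n)" by (rule sign_avg_cmult)
  \<comment> \<open>This gives the constant the form of a power of order \<open>2 * m\<close>, as
    the tail comparison demands.\<close>
  also have "\<dots> \<le> Q ^ ?n * sign_avg I (\<lambda>e. ?R e ^ ?n)"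
  proof (rule mult_right_mono)
    show "Q \<le> Q ^ ?n" using Q_ge_1 assms power_increasing[of 1 ?n Q] by simp
    show "0 \<le> sign_avg I (\<lambda>e. ?R e ^ ?n)"
      unfolding sign_avg_def by (intro divide_nonneg_nonneg sum_nonneg) (auto simp: zero_le_even_power)
  qed
  finally show ?thesis
    using D0 by (simp add: power_divide power_mult_distrib pos_divide_le_eq mult_ac)
qed

text \<open>Jensen's inequality for a weight whose mass is at most \<open>Q\<close> but need not be
  1.\<close>

lemma riesz_pairing_power:
  assumes e: "e \<in> signs I" and F: "bmeas M F" and m: "m \<ge> 1"
  shows "(expectation (\<lambda>x. riesz D g I e x * F x)) ^ (2 * m)
    \<le> Q ^ (2 * m) * expectation (\<lambda>x. riesz D g I e x * F x ^ (2 * m))"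
proof -
  let ?P = "riesz D g I e"
  let ?n = "2 * m"
  define G where "G = expectation (\<lambda>x. ?P x * F x)"
  \<comment> \<open>Tangency at \<open>G / Q\<close>, not at the true mean \<open>G / q\<close>,
    avoids dividing by \<open>q\<close> and works because \<open>q \<le> Q\<close>.\<close>
  define c where "c = G / Q"
  define q where "q = expectation ?P"
  define E where "E = expectation (\<lambda>x. ?P x * F x ^ ?n)"
  have q: "q \<le> Q" unfolding q_def using e by (rule riesz_mass)
  have E0: "E \<ge> 0" unfolding E_def using e
    by (intro Bochner_Integration.integral_nonneg mult_nonneg_nonneg riesz_nonneg) (auto simp: zero_le_even_power)
  have cG: "G = Q * c" using Q_ge_1 by (simp add: c_def)
  have c0: "c ^ ?n \<ge> 0" by (simp add: zero_le_even_power)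
  have cn: "c ^ (?n - 1) * c = c ^ ?n" using m power_minus_mult[of ?n c] by simp
  have "Q * c ^ ?n \<le> (q + ?n * (Q - q)) * c ^ ?n"
  proof (rule mult_right_mono[OF _ c0])
    have "1 * (Q - q) \<le> real ?n * (Q - q)" using m q by (intro mult_right_mono) auto
    then show "Q \<le> q + ?n * (Q - q)" by simp
  qed
  also have "\<dots> = (c ^ ?n - ?n * (c ^ (?n - 1) * c)) * q + ?n * c ^ (?n - 1) * G"
    unfolding cG cn using cn by (simp add: algebra_simps)
  also have "\<dots> = expectation (\<lambda>x. (c ^ ?n - ?n * (c ^ (?n - 1) * c)) * ?P x + ?n * c ^ (?n - 1) * (?P x * F x))"
    unfolding q_def G_def using F by (subst Bochner_Integration.integral_add) auto
  also have "\<dots> \<le> E" unfolding E_def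
  proof (rule integral_mono)
    fix x assume "x \<in> space M"
    then have "?P x * (c ^ ?n + ?n * c ^ (?n - 1) * (F x - c)) \<le> ?P x * F x ^ ?n"
      using e by (intro mult_left_mono even_power_tangent riesz_nonneg) auto
    then show "(c ^ ?n - ?n * (c ^ (?n - 1) * c)) * ?P x + ?n * c ^ (?n - 1) * (?P x * F x) \<le> ?P x * F x ^ ?n"
      by (simp add: algebra_simps)
  qed (use F in auto)
  finally have "Q * c ^ ?n \<le> E" .
  moreover have "1 * c ^ ?n \<le> Q * c ^ ?n" using Q_ge_1 c0 by (intro mult_right_mono) auto
  ultimately have "Q ^ ?n * c ^ ?n \<le> Q ^ ?n * E" using Q_ge_1 by (intro mult_left_mono) auto
  then show ?thesis by (simp add: cG power_mult_distrib flip: G_def E_def)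
qed

text \<open>Pairing the sum with a Riesz product and multiplying by \<open>D\<close> recovers
  \<open>rad_sum I a e\<close> up to \<open>B * A\<close>, where \<open>A\<close> is the quadratic
  norm and thus at most the norm of order \<open>2 * m\<close>. The main term goes through
  \<open>riesz_pairing_power\<close>; averaged over \<open>e\<close>, the products give 1.\<close>

lemma moment_lower:
  assumes m: "m \<ge> 1"
  shows "sign_avg I (\<lambda>e. rad_sum I a e ^ (2 * m))
    \<le> (2 * (D * Q + 2 * D ^ 3 * K)) ^ (2 * m) * expectation (\<lambda>x. (\<Sum>i\<in>I. a i * g i x) ^ (2 * m))"
proof -
  let ?F = "\<lambda>x. \<Sum>i\<in>I. a i * g i x"
  let ?R = "rad_sum I a"
  let ?P = "riesz D g I"
  let ?n = "2 * m"
  define W where "W = expectation (\<lambda>x. ?F x ^ ?n)"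
  define A where "A = sqrt (\<Sum>i\<in>I. (a i)\<^sup>2)"
  define G where "G e = expectation (\<lambda>x. ?P e x * ?F x)" for e
  define B where "B = 2 * D ^ 3 * K"
  have W0: "W \<ge> 0" unfolding W_def
    by (rule Bochner_Integration.integral_nonneg) (simp add: zero_le_even_power)
  have bF: "bmeas M ?F" by auto
  have A2: "A\<^sup>2 = expectation (\<lambda>x. (?F x)\<^sup>2)"
    unfolding A_def expectation_square_sum[OF order_refl] by (simp add: sum_nonneg)
  have A0: "A \<ge> 0" by (simp add: A_def sum_nonneg)
  have AW: "A ^ ?n \<le> W"
    unfolding W_def power_mult A2 using moment_mono[OF bF, of m] by (simp add: power_mult)
  have a_le: "\<bar>a j\<bar> \<le> A" if "j \<in> I" for j
    unfolding A_def using that finite_I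
    by (intro real_le_rsqrt) (auto intro!: member_le_sum)
  have B0: "B \<ge> 0" using K_nonneg D_ge_1 by (simp add: B_def)
  \<comment> \<open>There are \<open>card I\<close> summands, each at most
    \<open>A * (2 * D * card I * \<eta>)\<close>; by \<open>\<eta>_le\<close> they add up to at most
    \<open>2 * D * A * (D\<^sup>2 * K)\<close>. This is where \<open>B\<close> comes from.\<close>
  have err: "\<bar>?R e - D * G e\<bar> \<le> B * A" if e: "e \<in> signs I" for e
  proof -
    have "G e = expectation (\<lambda>x. \<Sum>j\<in>I. a j * (?P e x * g j x))"
      by (simp add: G_def sum_distrib_left algebra_simps)
    also have "\<dots> = (\<Sum>j\<in>I. a j * expectation (\<lambda>x. ?P e x * g j x))"
      by (simp add: Bochner_Integration.integral_sum)
    finally have "D * G e - ?R e = (\<Sum>j\<in>I. a j * (D * expectation (\<lambda>x. ?P e x * g j x) - e j))"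
      by (simp add: rad_sum_def sum_distrib_left sum_subtractf algebra_simps)
    also have "\<bar>\<dots>\<bar> \<le> (\<Sum>j\<in>I. A * (2 * D * real (card I) * \<eta>))"
      using a_le riesz_coeff[OF e] A0
      by (intro order_trans[OF sum_abs] sum_mono) (auto simp: abs_mult intro!: mult_mono)
    also have "\<dots> = 2 * D * A * ((card I)\<^sup>2 * \<eta>)" by (simp add: power2_eq_square)
    also have "\<dots> \<le> 2 * D * A * (D\<^sup>2 * K)"
      using \<eta>_le A0 D_ge_1 by (intro mult_left_mono) auto
    finally show ?thesis by (simp add: B_def power3_eq_cube power2_eq_square abs_minus_commute mult_ac)
  qed
  have "sign_avg I (\<lambda>e. ?R e ^ ?n) \<le> sign_avg I (\<lambda>e. 2 ^ ?n * ((D * Q) ^ ?n * expectation (\<lambda>x. ?P e x * ?F x ^ ?n) + (B * A) ^ ?n))"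
  proof (rule sign_avg_mono)
    fix e assume e: "e \<in> signs I"
    have "?R e ^ ?n = (D * G e + (?R e - D * G e)) ^ ?n" by simp
    also have "\<dots> \<le> 2 ^ ?n * ((D * G e) ^ ?n + (?R e - D * G e) ^ ?n)" by (rule even_power_add_le)
    also have "\<dots> \<le> 2 ^ ?n * ((D * Q) ^ ?n * expectation (\<lambda>x. ?P e x * ?F x ^ ?n) + (B * A) ^ ?n)"
    proof (intro mult_left_mono add_mono)
      have "D ^ ?n * G e ^ ?n \<le> D ^ ?n * (Q ^ ?n * expectation (\<lambda>x. ?P e x * ?F x ^ ?n))"
        unfolding G_def using D_ge_1 by (intro mult_left_mono riesz_pairing_power e bF m) auto
      then show "(D * G e) ^ ?n \<le> (D * Q) ^ ?n * expectation (\<lambda>x. ?P e x * ?F x ^ ?n)"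
        by (simp add: power_mult_distrib)
      have "\<bar>?R e - D * G e\<bar> ^ ?n \<le> (B * A) ^ ?n" using err[OF e] by (intro power_mono) auto
      then show "(?R e - D * G e) ^ ?n \<le> (B * A) ^ ?n" by (simp add: power_even_abs)
    qed simp
    finally show "?R e ^ ?n \<le> 2 ^ ?n * ((D * Q) ^ ?n * expectation (\<lambda>x. ?P e x * ?F x ^ ?n) + (B * A) ^ ?n)" .
  qed
  also have "\<dots> = 2 ^ ?n * ((D * Q) ^ ?n * sign_avg I (\<lambda>e. expectation (\<lambda>x. ?P e x * ?F x ^ ?n)) + (B * A) ^ ?n)"
    by (simp only: sign_avg_cmult sign_avg_add sign_avg_const[OF finite_I])
  also have "sign_avg I (\<lambda>e. expectation (\<lambda>x. ?P e x * ?F x ^ ?n)) = expectation (\<lambda>x. ?F x ^ ?n * sign_avg I (\<lambda>e. ?P e x))"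
    unfolding sign_avg_cmult[symmetric] using bF by (subst expectation_sign_avg) (auto simp: mult.commute)
  also have "\<dots> = W" by (simp add: sign_avg_riesz W_def)
  also have "2 ^ ?n * ((D * Q) ^ ?n * W + (B * A) ^ ?n) \<le> 2 ^ ?n * ((D * Q) ^ ?n * W + B ^ ?n * W)"
    using AW B0 by (auto simp: power_mult_distrib intro!: mult_left_mono)
  also have "\<dots> = 2 ^ ?n * (((D * Q) ^ ?n + B ^ ?n) * W)" by (simp add: algebra_simps)
  also have "\<dots> \<le> 2 ^ ?n * ((D * Q + B) ^ ?n * W)"
  proof (intro mult_left_mono mult_right_mono W0)
    have "0 \<le> D * Q" using D_ge_1 Q_ge_1 by simp
    then show "(D * Q) ^ ?n + B ^ ?n \<le> (D * Q + B) ^ ?n"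
    proof -
      obtain l where l: "?n = Suc l" using m by (cases ?n) auto
      have "(D * Q) * (D * Q) ^ l + B * B ^ l \<le> (D * Q) * (D * Q + B) ^ l + B * (D * Q + B) ^ l"
        using \<open>0 \<le> D * Q\<close> B0 by (intro add_mono mult_left_mono power_mono) auto
      then show ?thesis by (simp only: l power_Suc distrib_right)
    qed
  qed simp
  also have "\<dots> = (2 * (D * Q + B)) ^ ?n * W" by (simp only: power_mult_distrib mult.assoc)
  finally show ?thesis by (simp only: W_def B_def)
qed

end

section \<open>Selection of the subsystem\<close>

context almost_independent
begin

text \<open>Apart from being bounded and measurable, \<open>R\<close> enters through its even
  moments alone, so the sum of Rademacher functions on [0,1] can take its place.\<close>

lemma tail_equivalence:
  assumes R: "bmeas M R"
    and moments: "\<And>m. expectation (\<lambda>x. R x ^ (2 * m)) = sign_avg I (\<lambda>e. rad_sum I a e ^ (2 * m))"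
    and L: "L = 2 * (D * Q + 2 * D ^ 3 * K)" and C: "C = 2 * L * (2 * L\<^sup>2) ^ 4" and z: "z > 0"
  shows "1 / C * prob {x \<in> space M. \<bar>R x\<bar> > C * z} \<le> prob {x \<in> space M. \<bar>\<Sum>i\<in>I. a i * g i x\<bar> > z}"
    and "prob {x \<in> space M. \<bar>\<Sum>i\<in>I. a i * g i x\<bar> > z} \<le> C * prob {x \<in> space M. \<bar>R x\<bar> > z / C}"
proof -
  let ?F = "\<lambda>x. \<Sum>i\<in>I. a i * g i x"
  have bF: "bmeas M ?F" by auto
  have DQ: "1 \<le> D * Q" using mult_mono[OF D_ge_1 Q_ge_1] D_ge_1 by simp
  have "0 \<le> D ^ 3 * K" using D_ge_1 K_nonneg by simp
  then have L1: "1 \<le> L" "D * Q \<le> L" using DQ unfolding L by (simp_all add: mult.assoc)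
  then have "L\<^sup>2 \<ge> 1" by simp
  then have "(2 * 1) ^ 4 \<le> (2 * L\<^sup>2) ^ 4" by (intro power_mono) auto
  then have C1: "2 * L * 2 ^ 4 \<le> C" unfolding C using L1 by (intro mult_left_mono) auto
  then have C0: "C > 0" using L1 by simp
  have nonneg: "0 \<le> expectation (\<lambda>x. h x ^ (2 * m))" for h :: "_ \<Rightarrow> real" and m
    by (rule Bochner_Integration.integral_nonneg) (simp add: zero_le_even_power)
  have FR: "expectation (\<lambda>x. ?F x ^ (2 * m)) \<le> L ^ (2 * m) * expectation (\<lambda>x. R x ^ (2 * m))"
    if "m \<ge> 1" for m
  proof -
    have "expectation (\<lambda>x. ?F x ^ (2 * m)) \<le> (D * Q) ^ (2 * m) * expectation (\<lambda>x. R x ^ (2 * m))"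
      using moment_upper[OF that, of a] by (simp add: moments)
    also have "\<dots> \<le> L ^ (2 * m) * expectation (\<lambda>x. R x ^ (2 * m))"
      using L1 DQ by (intro mult_right_mono power_mono nonneg) auto
    finally show ?thesis .
  qed
  have RF: "expectation (\<lambda>x. R x ^ (2 * m)) \<le> L ^ (2 * m) * expectation (\<lambda>x. ?F x ^ (2 * m))"
    if "m \<ge> 1" for m
    using moment_lower[OF that, of a] by (simp add: moments L)
  have RR: "expectation (\<lambda>x. R x ^ (4 * m)) \<le> 2 ^ (4 * m) * (expectation (\<lambda>x. R x ^ (2 * m)))\<^sup>2" for m
    using rademacher_hypercontractive[OF finite_I, of a m] moments[of "2 * m"] moments[of m]
    by (simp add: mult.assoc)
  \<comment> \<open>Passing from \<open>?F\<close> to \<open>R\<close>, from order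
    \<open>4 * m\<close> to \<open>2 * m\<close>, and back to \<open>?F\<close> costs the factors
    \<open>L\<close>, 2 and \<open>L\<close>. Their product \<open>2 * L\<^sup>2\<close> is the
    \<open>K\<close> of the second comparison and appears in \<open>C\<close>.\<close>
  have FF: "expectation (\<lambda>x. ?F x ^ (4 * m)) \<le> (2 * L\<^sup>2) ^ (4 * m) * (expectation (\<lambda>x. ?F x ^ (2 * m)))\<^sup>2"
    if m: "m \<ge> 1" for m
  proof -
    have "expectation (\<lambda>x. ?F x ^ (4 * m)) \<le> L ^ (4 * m) * expectation (\<lambda>x. R x ^ (4 * m))"
      using FR[of "2 * m"] m by simp
    also have "\<dots> \<le> L ^ (4 * m) * (2 ^ (4 * m) * (L ^ (2 * m) * expectation (\<lambda>x. ?F x ^ (2 * m)))\<^sup>2)"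
      using L1 by (intro mult_left_mono order_trans[OF RR] power_mono RF m nonneg) auto
    also have "\<dots> = (2 * L\<^sup>2) ^ (4 * m) * (expectation (\<lambda>x. ?F x ^ (2 * m)))\<^sup>2"
      by (simp add: power_mult_distrib mult_ac flip: power_mult power_add)
    finally show ?thesis .
  qed
  show "prob {x \<in> space M. \<bar>?F x\<bar> > z} \<le> C * prob {x \<in> space M. \<bar>R x\<bar> > z / C}"
    using FR RR C1 L1 z by (intro tail_comparison[where K = 2 and L = L] bF R) auto
  \<comment> \<open>The threshold is \<open>C * z\<close>, so that the tail on the right is taken at
    \<open>z\<close>.\<close>
  have "prob {x \<in> space M. \<bar>R x\<bar> > C * z} \<le> C * prob {x \<in> space M. \<bar>?F x\<bar> > C * z / C}"
    using RF FF L1 z C0 \<open>L\<^sup>2 \<ge> 1\<close>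
    by (intro tail_comparison[where K = "2 * L\<^sup>2" and L = L] bF R) (auto simp: C)
  then show "1 / C * prob {x \<in> space M. \<bar>R x\<bar> > C * z} \<le> prob {x \<in> space M. \<bar>?F x\<bar> > z}"
    using C0 by (simp add: pos_divide_le_eq mult.commute)
qed

end

section \<open>Choosing one index from each block\<close>

lemma exists_average_le:
  fixes V :: "'l \<Rightarrow> 'h \<Rightarrow> real" and \<beta> :: real
  assumes H: "finite H" "H \<noteq> {}" and \<Lambda>: "finite \<Lambda>"
    and V0: "\<And>l h. V l h \<ge> 0"
    and avg: "\<And>l. l \<in> \<Lambda> \<Longrightarrow> (\<Sum>h\<in>H. V l h) \<le> \<beta> * card H"
  shows "\<exists>h\<in>H. \<forall>l\<in>\<Lambda>. V l h \<le> card \<Lambda> * \<beta>"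
proof -
  have "\<exists>h\<in>H. (\<Sum>l\<in>\<Lambda>. V l h) \<le> card \<Lambda> * \<beta>"
  proof (rule ccontr)
    assume "\<not> ?thesis"
    then have "(\<Sum>h\<in>H. card \<Lambda> * \<beta>) < (\<Sum>h\<in>H. \<Sum>l\<in>\<Lambda>. V l h)"
      using H by (intro sum_strict_mono) (auto simp: not_le)
    also have "\<dots> = (\<Sum>l\<in>\<Lambda>. \<Sum>h\<in>H. V l h)" by (rule sum.swap)
    also have "\<dots> \<le> (\<Sum>l\<in>\<Lambda>. \<beta> * card H)" by (intro sum_mono avg)
    finally show False by (simp add: mult_ac)
  qed
  then obtain h where h: "h \<in> H" "(\<Sum>l\<in>\<Lambda>. V l h) \<le> card \<Lambda> * \<beta>" by blast
  have "V l h \<le> (\<Sum>l\<in>\<Lambda>. V l h)" if "l \<in> \<Lambda>" for l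
    using \<Lambda> that V0 by (intro member_le_sum) auto
  then show ?thesis using h by (meson order_trans)
qed

context bounded_orthonormal
begin

text \<open>\<open>G h\<close> ignores the coordinate \<open>h k\<close>, so with the others fixed
  Bessel's inequality bounds the sum over all \<open>m\<close> choices of \<open>h k\<close> by
  \<open>\<Gamma>\<^sup>2\<close>; this gains the factor \<open>1 / m\<close>.\<close>

lemma block_average:
  fixes J :: "'k set" and G :: "('k \<Rightarrow> 'i) \<Rightarrow> 'a \<Rightarrow> real"
  assumes J: "finite J" "k \<in> J" and B: "\<And>j. j \<in> J \<Longrightarrow> B j \<subseteq> I" "\<And>j. j \<in> J \<Longrightarrow> card (B j) = m" and m: "m \<ge> 1"
    and bG: "\<And>h. h \<in> PiE J B \<Longrightarrow> bmeas M (G h)"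
    and G_le: "\<And>h x. h \<in> PiE J B \<Longrightarrow> x \<in> space M \<Longrightarrow> \<bar>G h x\<bar> \<le> \<Gamma>"
    and indep: "\<And>h n n'. G (h(k := n)) = G (h(k := n'))"
  shows "(\<Sum>h\<in>PiE J B. (expectation (\<lambda>x. G h x * g (h k) x))\<^sup>2) \<le> \<Gamma>\<^sup>2 / m * card (PiE J B)"
proof -
  let ?J = "J - {k}"
  have J_eq: "J = insert k ?J" using J by auto
  have cards: "card (PiE J B) = m ^ card J" "card (PiE ?J B) = m ^ card ?J"
    using J B by (simp_all add: card_PiE)
  have "(\<Sum>h\<in>PiE J B. (expectation (\<lambda>x. G h x * g (h k) x))\<^sup>2)
      = (\<Sum>h\<in>PiE ?J B. \<Sum>n\<in>B k. (expectation (\<lambda>x. G (h(k := n)) x * g n x))\<^sup>2)"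
    by (subst J_eq, subst sum_PiE_insert) auto
  also have "\<dots> \<le> (\<Sum>h\<in>PiE ?J B. \<Gamma>\<^sup>2)"
  proof (rule sum_mono)
    fix h assume h: "h \<in> PiE ?J B"
    obtain n0 where n0: "n0 \<in> B k" using B(2)[OF J(2)] m by (cases "B k = {}") auto
    let ?h = "h(k := n0)"
    have h': "?h \<in> PiE J B" using h n0 J by (subst J_eq, subst PiE_insert_eq) auto
    have "(\<Sum>n\<in>B k. (expectation (\<lambda>x. G (h(k := n)) x * g n x))\<^sup>2)
        = (\<Sum>n\<in>B k. (expectation (\<lambda>x. G ?h x * g n x))\<^sup>2)"
      by (subst indep[of h _ n0]) simp
    also have "\<dots> \<le> expectation (\<lambda>x. (G ?h x)\<^sup>2)" using B J bG[OF h'] by (intro bessel) auto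
    also have "\<dots> \<le> expectation (\<lambda>x. \<Gamma>\<^sup>2)"
    proof (rule integral_mono)
      show "(G ?h x)\<^sup>2 \<le> \<Gamma>\<^sup>2" if "x \<in> space M" for x
        using power_mono[OF G_le[OF h' that], of 2] by simp
    qed (use bG[OF h'] in auto)
    finally show "(\<Sum>n\<in>B k. (expectation (\<lambda>x. G (h(k := n)) x * g n x))\<^sup>2) \<le> \<Gamma>\<^sup>2"
      by (simp add: prob_space)
  qed
  also have "\<dots> = \<Gamma>\<^sup>2 * m ^ card ?J" by (simp add: cards)
  also have "\<dots> = \<Gamma>\<^sup>2 / m * card (PiE J B)"
  proof -
    have "card J = Suc (card ?J)" using J by (metis card_Suc_Diff1)
    then show ?thesis using m unfolding cards by simp
  qed
  finally show ?thesis .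
qed

text \<open>\<open>K_ge\<close> balances the number of conditions against the block length: the mean
  squares, summed over all conditions, must stay below \<open>\<eta>\<^sup>2\<close>.\<close>

lemma exists_almost_independent:
  fixes J :: "'k set" and B :: "'k \<Rightarrow> 'i set" and K :: real
  assumes J: "finite J" "J \<noteq> {}" and B: "\<And>j. j \<in> J \<Longrightarrow> B j \<subseteq> I" "\<And>j. j \<in> J \<Longrightarrow> card (B j) = m" and m: "m \<ge> 1"
    and disj: "disjoint_family_on B J" and K: "K \<ge> 0"
    and K_ge: "real (card J) ^ 5 * (real (card J) + 1) * 16 ^ card J \<le> K\<^sup>2 * real m"
  shows "\<exists>h\<in>PiE J B. \<exists>\<eta>. almost_independent M J (\<lambda>j. g (h j)) D \<eta> K"
proof -
  let ?s = "card J"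
  have s: "real ?s > 0" using J by (simp add: card_gt_0_iff)
  have fB: "finite (B j)" if "j \<in> J" for j using B(1)[OF that] finite_I finite_subset by blast
  have interp: "bounded_orthonormal M J (\<lambda>j. g (h j)) D" if h: "h \<in> PiE J B" for h
  proof unfold_locales
    have hI: "h j \<in> I" if "j \<in> J" for j using h that B by (auto simp: PiE_iff)
    show "finite J" "J \<noteq> {}" by fact+
    show "g (h i) \<in> borel_measurable M" if "i \<in> J" for i using hI[OF that] by (rule measurable_g)
    show "\<bar>g (h i) x\<bar> \<le> D" if "i \<in> J" "x \<in> space M" for i x using hI that by (intro bounded) auto
    fix i j assume ij: "i \<in> J" "j \<in> J"
    have "h i = h j \<longleftrightarrow> i = j"
      using disj ij h by (fastforce simp: disjoint_family_on_def PiE_iff)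
    then show "expectation (\<lambda>x. g (h i) x * g (h j) x) = (if i = j then 1 else 0)"
      using orthonormal[OF hI[OF ij(1)] hI[OF ij(2)]] by simp
  qed
  \<comment> \<open>\<open>None\<close> and \<open>Some j\<close> encode the weights of the two families of conditions in \<open>almost_independent\<close>.\<close>
  define w :: "'k option \<Rightarrow> ('k \<Rightarrow> 'i) \<Rightarrow> 'a \<Rightarrow> real"
    where "w u h x = (case u of None \<Rightarrow> 1 | Some j \<Rightarrow> (g (h j) x)\<^sup>2)" for u h x
  define G where "G = (\<lambda>(e, S, u) h x. w u h x * riesz D (\<lambda>j. g (h j)) S e x)"
  define U where "U = insert None (Some ` J)"
  \<comment> \<open>The requirements \<open>k \<notin> S\<close> and
    \<open>u \<noteq> Some k\<close> keep \<open>h k\<close> out of \<open>G\<close>, as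
    \<open>block_average\<close> demands.\<close>
  define \<Lambda> where "\<Lambda> = {((e, S, u), k). e \<in> signs J \<and> S \<subseteq> J \<and> u \<in> U \<and> k \<in> J \<and> k \<notin> S \<and> u \<noteq> Some k}"
  define V where "V = (\<lambda>(p, k) h. (expectation (\<lambda>x. G p h x * g (h k) x))\<^sup>2)"
  define \<Gamma> where "\<Gamma> = D\<^sup>2 * 2 ^ ?s"
  \<comment> \<open>The largest error that \<open>almost_independent\<close> admits for the given
    \<open>K\<close>.\<close>
  define \<eta> where "\<eta> = D\<^sup>2 * K / (real ?s)\<^sup>2"
  have sub: "\<Lambda> \<subseteq> (signs J \<times> Pow J \<times> U) \<times> J" by (auto simp: \<Lambda>_def)
  have fin: "finite ((signs J \<times> Pow J \<times> U) \<times> J)" using J by (simp add: U_def)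
  have card_\<Lambda>: "card \<Lambda> \<le> 2 ^ ?s * (2 ^ ?s * (?s + 1)) * ?s"
  proof -
    have "card U = ?s + 1" using J by (simp add: U_def card_image)
    then show ?thesis
      using card_mono[OF fin sub] J by (simp add: card_cartesian_product card_signs card_Pow)
  qed
  have avg: "(\<Sum>h\<in>PiE J B. V l h) \<le> \<Gamma>\<^sup>2 / m * card (PiE J B)" if l: "l \<in> \<Lambda>" for l
  proof -
    obtain e S u k where l_eq: "l = ((e, S, u), k)" by (metis surj_pair)
    have l': "e \<in> signs J" "S \<subseteq> J" "u \<in> U" "k \<in> J" "k \<notin> S" "u \<noteq> Some k"
      using l by (auto simp: l_eq \<Lambda>_def)
    show ?thesis unfolding l_eq V_def prod.case
    proof (rule block_average[OF J(1) l'(4) B m])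
      fix h assume h: "h \<in> PiE J B"
      interpret h: bounded_orthonormal M J "\<lambda>j. g (h j)" D by (rule interp[OF h])
      have bw: "bmeas M (w u h)" unfolding w_def using l'(3) by (auto simp: U_def split: option.split)
      then show "bmeas M (G (e, S, u) h)" unfolding G_def prod.case using l' by auto
      fix x assume x: "x \<in> space M"
      have "D\<^sup>2 \<ge> 1" using D_ge_1 by simp
      then have "\<bar>w u h x\<bar> \<le> D\<^sup>2"
        using l'(3) x power_mono[OF h.bounded[OF _ x], of _ 2] by (auto simp: U_def w_def)
      moreover have "\<bar>riesz D (\<lambda>j. g (h j)) S e x\<bar> \<le> 2 ^ ?s"
        using h.riesz_le[OF l'(1,2) x] h.riesz_nonneg[OF l'(1,2) x] by simp
      ultimately show "\<bar>G (e, S, u) h x\<bar> \<le> \<Gamma>"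
        unfolding G_def \<Gamma>_def prod.case abs_mult by (intro mult_mono) auto
    next
      fix h n n'
      have "w u (h(k := n)) = w u (h(k := n'))"
        using l'(6) by (auto simp: w_def fun_eq_iff split: option.split)
      moreover have "riesz D (\<lambda>j. g ((h(k := n)) j)) S e = riesz D (\<lambda>j. g ((h(k := n')) j)) S e"
        unfolding riesz_def using l'(5) by (intro ext prod.cong) auto
      ultimately show "G (e, S, u) (h(k := n)) = G (e, S, u) (h(k := n'))"
        by (simp add: G_def fun_eq_iff)
    qed
  qed
  have "\<exists>h\<in>PiE J B. \<forall>l\<in>\<Lambda>. V l h \<le> card \<Lambda> * (\<Gamma>\<^sup>2 / m)"
  proof (rule exists_average_le)
    show "finite (PiE J B)" using J fB by (intro finite_PiE) auto
    have "B j \<noteq> {}" if "j \<in> J" for j using B(2)[OF that] m by auto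
    then show "PiE J B \<noteq> {}" by (simp add: PiE_eq_empty_iff)
    show "finite \<Lambda>" using sub fin finite_subset by blast
    show "V l h \<ge> 0" for l h by (cases l) (simp add: V_def)
  qed (rule avg)
  then obtain h where h: "h \<in> PiE J B" and V: "\<And>l. l \<in> \<Lambda> \<Longrightarrow> V l h \<le> card \<Lambda> * (\<Gamma>\<^sup>2 / m)" by blast
  interpret h: bounded_orthonormal M J "\<lambda>j. g (h j)" D by (rule interp[OF h])
  have \<eta>0: "\<eta> \<ge> 0" using K by (simp add: \<eta>_def)
  have "card \<Lambda> * (\<Gamma>\<^sup>2 / m) \<le> real (2 ^ ?s * (2 ^ ?s * (?s + 1)) * ?s) * (\<Gamma>\<^sup>2 / m)"
    by (intro mult_right_mono of_nat_mono card_\<Lambda>) auto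
  \<comment> \<open>\<open>16 ^ ?s\<close> is \<open>4 ^ ?s\<close> from the count of conditions
    times \<open>4 ^ ?s\<close> from \<open>\<Gamma>\<^sup>2\<close>. In \<open>?s ^ 5\<close> one
    factor comes from the count and four match the denominator of
    \<open>\<eta>\<^sup>2\<close>.\<close>
  also have "\<dots> = D ^ 4 * (real ?s ^ 5 * (real ?s + 1) * 16 ^ ?s) / m / real ?s ^ 4"
  proof -
    have "(16::real) ^ ?s = 2 ^ ?s * 2 ^ ?s * (2 ^ ?s)\<^sup>2"
      by (simp add: power2_eq_square flip: power_mult_distrib)
    then show ?thesis
      using s by (simp add: \<Gamma>_def power_mult_distrib power_numeral_reduce) (simp add: algebra_simps)
  qed
  also have "\<dots> \<le> D ^ 4 * (K\<^sup>2 * real m) / m / real ?s ^ 4"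
    using K_ge by (intro divide_right_mono mult_left_mono) auto
  also have "\<dots> = \<eta>\<^sup>2" using m by (simp add: \<eta>_def power_divide power_mult_distrib flip: power_mult)
  finally have bound: "card \<Lambda> * (\<Gamma>\<^sup>2 / m) \<le> \<eta>\<^sup>2" .
  have le: "\<bar>expectation (\<lambda>x. G p h x * g (h k) x)\<bar> \<le> \<eta>" if "(p, k) \<in> \<Lambda>" for p k
  proof -
    have "(expectation (\<lambda>x. G p h x * g (h k) x))\<^sup>2 \<le> \<eta>\<^sup>2"
      using order_trans[OF V[OF that] bound] by (simp add: V_def)
    then show ?thesis using \<eta>0 by (simp flip: abs_le_square_iff)
  qed
  have "almost_independent M J (\<lambda>j. g (h j)) D \<eta> K"
  proof unfold_locales
    show "\<bar>expectation (\<lambda>x. riesz D (\<lambda>j. g (h j)) S e x * g (h k) x)\<bar> \<le> \<eta>"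
      if "e \<in> signs J" "S \<subseteq> J" "k \<in> J - S" for e S k
      using le[of "(e, S, None)" k] that by (simp add: \<Lambda>_def U_def G_def w_def)
    show "\<bar>expectation (\<lambda>x. (g (h j) x)\<^sup>2 * riesz D (\<lambda>j. g (h j)) S e x * g (h k) x)\<bar> \<le> \<eta>"
      if "e \<in> signs J" "j \<in> J" "S \<subseteq> J - {j}" "k \<in> J - {j} - S" for e S j k
    proof -
      have "((e, S, Some j), k) \<in> \<Lambda>" using that by (auto simp: \<Lambda>_def U_def)
      from le[OF this] show ?thesis by (simp add: G_def w_def)
    qed
    show "(real ?s)\<^sup>2 * \<eta> \<le> D\<^sup>2 * K" using s by (simp add: \<eta>_def)
  qed (rule \<eta>0)
  then show ?thesis using h by blast
qed

end

section \<open>The unit interval and the final constants\<close>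

lemma bmeas_rademacher: "bmeas (lebesgue_on {0..1}) (rademacher i)"
proof (rule bmeasI)
  have "rademacher i \<in> borel_measurable borel" unfolding rademacher_def by measurable
  then have "rademacher i \<in> borel_measurable lebesgue" by (simp add: measurable_completion)
  then show "rademacher i \<in> borel_measurable (lebesgue_on {0..1})" by (rule measurable_restrict_space1)
  show "\<bar>rademacher i x\<bar> \<le> 1" for x by (simp add: rademacher_def sgn_if)
qed

lemma prob_space_lebesgue_01: "prob_space (lebesgue_on {0..1::real})"
  by (rule prob_spaceI) (simp add: emeasure_restrict_space)

lemma rademacher_even_moment:
  assumes "s \<ge> 1"
  shows "integral\<^sup>L (lebesgue_on {0..1}) (\<lambda>x. (\<Sum>i=1..s. a i * rademacher i x) ^ (2 * m))
    = sign_avg {1..s} (\<lambda>e. rad_sum {1..s} a e ^ (2 * m))"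
proof -
  interpret prob_space "lebesgue_on {0..1::real}" by (rule prob_space_lebesgue_01)
  have "integral\<^sup>L (lebesgue_on {0..1}) (\<lambda>x. (\<Sum>i=1..s. a i * rademacher i x) ^ (2 * m))
      = integral {0..1} (\<lambda>x. (\<Sum>i=1..s. a i * rademacher i x) ^ (2 * m))"
    by (intro lebesgue_integral_eq_integral bmeas_integrable bmeas_power bmeas_sum bmeas_mult bmeas_const bmeas_rademacher) auto
  also have "\<dots> = sign_avg {1..s} (\<lambda>e. rad_sum {1..s} a e ^ (2 * m))"
    using rademacher_has_integral[OF assms, of "\<lambda>u. u ^ (2 * m)" a] by (intro integral_unique) simp
  finally show ?thesis .
qed

lemma prob_lebesgue_01:
  "measure (lebesgue_on {0..1}) {x \<in> space (lebesgue_on {0..1}). P x} = measure lebesgue {x \<in> {0..1::real}. P x}"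
proof -
  have "{x \<in> space (lebesgue_on {0..1}). P x} = {x \<in> {0..1}. P x}" by auto
  then show ?thesis by (simp only:) (rule measure_restrict_space, auto)
qed

text \<open>As 16 < 32, the quotient tends to 0 and is bounded. \<open>K \<ge> 6\<close> serves the
  blocks of length 1 used for \<open>s = 1\<close>, where the left-hand side is 32 and
  \<open>K\<^sup>2 \<ge> 36\<close>.\<close>

lemma selection_size_constant:
  "\<exists>K::real. K \<ge> 6 \<and> (\<forall>s::nat. real s ^ 5 * (real s + 1) * 16 ^ s \<le> K\<^sup>2 * 32 ^ s)"
proof -
  have "(\<lambda>s::nat. real s ^ 5 * (real s + 1) * 16 ^ s / 32 ^ s) \<longlonglongrightarrow> 0" by real_asymp
  then have "Bseq (\<lambda>s::nat. real s ^ 5 * (real s + 1) * 16 ^ s / 32 ^ s)"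
    by (intro convergent_imp_Bseq convergentI)
  then obtain K0 where K0: "K0 > 0" "\<And>s::nat. \<bar>real s ^ 5 * (real s + 1) * 16 ^ s / 32 ^ s\<bar> \<le> K0"
    by (auto simp: Bseq_def)
  define K where "K = K0 + 6"
  have "K0 \<le> K * 1" "K * 1 \<le> K * K" using K0 by (auto simp: K_def intro!: mult_left_mono)
  then have K2: "K0 \<le> K\<^sup>2" by (simp add: power2_eq_square)
  have "real s ^ 5 * (real s + 1) * 16 ^ s \<le> K\<^sup>2 * 32 ^ s" for s
  proof -
    have "real s ^ 5 * (real s + 1) * 16 ^ s / 32 ^ s \<le> K\<^sup>2" using K0(2)[of s] K2 by linarith
    then show ?thesis by (simp add: pos_divide_le_eq)
  qed
  then show ?thesis using K0 by (intro exI[of _ K]) (simp add: K_def)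
qed

theorem theorem4p1:
  "\<forall>D::real. D > 0 \<longrightarrow> (\<exists>C::real. C > 0 \<and>
     (\<forall>(N::nat) (f::nat \<Rightarrow> real \<Rightarrow> real).
        N \<ge> 1 \<and> orthonormal_L2_01 N f \<and>
        (\<forall>n\<in>{1..N}. \<forall>x\<in>{0..1}. \<bar>f n x\<bar> \<le> D) \<longrightarrow>
        (\<exists>(s::nat) (idx::nat \<Rightarrow> nat).
           int s \<ge> max \<lfloor>log 2 (real N) / 6\<rfloor> 1 \<and>
           strict_mono_on {1..s} idx \<and> idx 1 \<ge> 1 \<and> idx s \<le> N \<and>
           (\<forall>(a::nat \<Rightarrow> real) (z::real). z > 0 \<longrightarrow>
              (1 / C) * measure lebesgue
                  {x \<in> {0..1}. \<bar>\<Sum>i=1..s. a i * rademacher i x\<bar> > C * z}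
                \<le> measure lebesgue
                  {x \<in> {0..1}. \<bar>\<Sum>i=1..s. a i * f (idx i) x\<bar> > z} \<and>
              measure lebesgue
                  {x \<in> {0..1}. \<bar>\<Sum>i=1..s. a i * f (idx i) x\<bar> > z}
                \<le> C * measure lebesgue
                  {x \<in> {0..1}. \<bar>\<Sum>i=1..s. a i * rademacher i x\<bar> > z / C}))))"
proof (intro allI impI)
  fix D :: real
  assume D: "D > 0"
  obtain K :: real where K6: "K \<ge> 6"
    and K: "\<And>s::nat. real s ^ 5 * (real s + 1) * 16 ^ s \<le> K\<^sup>2 * 32 ^ s"
    using selection_size_constant by blast
  \<comment> \<open>\<open>1 + D\<^sup>2 * K\<close> is the later \<open>Q\<close>; since
    \<open>K\<close> is absolute, \<open>L\<close> and \<open>C\<close> depend on \<open>D\<close>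
    only.\<close>
  define L where "L = 2 * (D * (1 + D\<^sup>2 * K) + 2 * D ^ 3 * K)"
  define C where "C = 2 * L * (2 * L\<^sup>2) ^ 4"
  have "L > 0" unfolding L_def using D K6 by (intro mult_pos_pos add_pos_pos) auto
  then have C0: "C > 0" by (simp add: C_def)
  show "\<exists>C::real. C > 0 \<and>
     (\<forall>(N::nat) (f::nat \<Rightarrow> real \<Rightarrow> real).
        N \<ge> 1 \<and> orthonormal_L2_01 N f \<and>
        (\<forall>n\<in>{1..N}. \<forall>x\<in>{0..1}. \<bar>f n x\<bar> \<le> D) \<longrightarrow>
        (\<exists>(s::nat) (idx::nat \<Rightarrow> nat).
           int s \<ge> max \<lfloor>log 2 (real N) / 6\<rfloor> 1 \<and>
           strict_mono_on {1..s} idx \<and> idx 1 \<ge> 1 \<and> idx s \<le> N \<and>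
           (\<forall>(a::nat \<Rightarrow> real) (z::real). z > 0 \<longrightarrow>
              (1 / C) * measure lebesgue
                  {x \<in> {0..1}. \<bar>\<Sum>i=1..s. a i * rademacher i x\<bar> > C * z}
                \<le> measure lebesgue
                  {x \<in> {0..1}. \<bar>\<Sum>i=1..s. a i * f (idx i) x\<bar> > z} \<and>
              measure lebesgue
                  {x \<in> {0..1}. \<bar>\<Sum>i=1..s. a i * f (idx i) x\<bar> > z}
                \<le> C * measure lebesgue
                  {x \<in> {0..1}. \<bar>\<Sum>i=1..s. a i * rademacher i x\<bar> > z / C})))"
  proof (intro exI[of _ C] conjI C0 allI impI)
    fix N :: nat and f :: "nat \<Rightarrow> real \<Rightarrow> real"
    assume asm: "N \<ge> 1 \<and> orthonormal_L2_01 N f \<and> (\<forall>n\<in>{1..N}. \<forall>x\<in>{0..1}. \<bar>f n x\<bar> \<le> D)"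
    interpret P: prob_space "lebesgue_on {0..1::real}" by (rule prob_space_lebesgue_01)
    interpret F: bounded_orthonormal "lebesgue_on {0..1::real}" "{1..N}" f D
      using asm by unfold_locales (auto simp: orthonormal_L2_01_def)
    define s where "s = nat (max \<lfloor>log 2 (real N) / 6\<rfloor> 1)"
    \<comment> \<open>For \<open>s = 1\<close> nothing is known beyond \<open>N \<ge> 1\<close>; the block then is a single index.\<close>
    define m :: nat where "m = (if s = 1 then 1 else 32 ^ s)"
    define B where "B i = {(i - 1) * m + 1..i * m}" for i
    have s1: "s \<ge> 1" and s_int: "int s = max \<lfloor>log 2 (real N) / 6\<rfloor> 1" by (auto simp: s_def)
    have m1: "m \<ge> 1" by (simp add: m_def)
    \<comment> \<open>Source of the 1/6: for \<open>s \<ge> 2\<close>,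
      \<open>s * 32 ^ s \<le> 2 ^ s * 32 ^ s = 2 ^ (6 * s) \<le> N\<close>.\<close>
    have smN: "s * m \<le> N"
    proof (cases "s = 1")
      case True
      then show ?thesis using asm by (simp add: m_def)
    next
      case False
      then have "int s = \<lfloor>log 2 (real N) / 6\<rfloor>" using s_int by linarith
      then have "6 * real s \<le> log 2 (real N)" by linarith
      then have "2 powr (6 * real s) \<le> real N" using asm by (subst (asm) le_log_iff) auto
      also have "2 powr (6 * real s) = (2 powr real (6 * s))" by simp
      also have "\<dots> = 64 ^ s" by (subst powr_realpow) (auto simp: power_mult)
      finally have "64 ^ s \<le> N" by (metis of_nat_le_iff of_nat_numeral of_nat_power)
      moreover have "s * 32 ^ s \<le> 2 ^ s * 32 ^ s" using less_exp[of s] by (intro mult_right_mono) auto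
      moreover have "2 ^ s * 32 ^ s = (64 :: nat) ^ s" by (simp flip: power_mult_distrib)
      ultimately show ?thesis using False by (simp add: m_def)
    qed
    have B_sub: "B i \<subseteq> {1..N}" if "i \<in> {1..s}" for i
    proof -
      have "i * m \<le> s * m" using that by (intro mult_right_mono) auto
      then have "i * m \<le> N" using smN by (rule order_trans)
      then show ?thesis by (auto simp: B_def)
    qed
    have B_card: "card (B i) = m" if "i \<in> {1..s}" for i
      using that by (cases i) (auto simp: B_def)
    \<comment> \<open>The order of the blocks yields both their disjointness and the monotonicity of
      \<open>idx\<close>.\<close>
    have B_less: "p < q" if "p \<in> B i" "q \<in> B j" "i < j" for p q i j
    proof -
      have "i * m \<le> (j - 1) * m" using that by (intro mult_right_mono) auto
      moreover have "p \<le> i * m" "(j - 1) * m < q" using that by (auto simp: B_def)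
      ultimately show ?thesis by linarith
    qed
    have "disjoint_family_on B {1..s}"
      unfolding disjoint_family_on_def using B_less by (metis disjoint_iff less_irrefl linorder_neqE_nat)
    moreover have "real s ^ 5 * (real s + 1) * 16 ^ s \<le> K\<^sup>2 * real m"
    proof (cases "s = 1")
      case True
      have "6\<^sup>2 \<le> K\<^sup>2" using K6 by (intro power_mono) auto
      then show ?thesis using True by (simp add: m_def)
    next
      case False
      then show ?thesis using K[of s] by (simp add: m_def)
    qed
    ultimately obtain idx \<eta> where idx: "idx \<in> PiE {1..s} B"
      and AI: "almost_independent (lebesgue_on {0..1}) {1..s} (\<lambda>i. f (idx i)) D \<eta> K"
      using F.exists_almost_independent[of "{1..s}" B m K] B_sub B_card m1 s1 K6 by auto
    interpret AI: almost_independent "lebesgue_on {0..1::real}" "{1..s}" "\<lambda>i. f (idx i)" D \<eta> K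
      by (rule AI)
    have idxB: "idx i \<in> B i" if "i \<in> {1..s}" for i using idx that by (auto simp: PiE_iff)
    have L: "L = 2 * (D * AI.Q + 2 * D ^ 3 * K)" by (simp add: L_def AI.Q_def)
    show "\<exists>s idx. int s \<ge> max \<lfloor>log 2 (real N) / 6\<rfloor> 1 \<and>
           strict_mono_on {1..s} idx \<and> idx 1 \<ge> 1 \<and> idx s \<le> N \<and>
           (\<forall>(a::nat \<Rightarrow> real) (z::real). z > 0 \<longrightarrow>
              (1 / C) * measure lebesgue
                  {x \<in> {0..1}. \<bar>\<Sum>i=1..s. a i * rademacher i x\<bar> > C * z}
                \<le> measure lebesgue
                  {x \<in> {0..1}. \<bar>\<Sum>i=1..s. a i * f (idx i) x\<bar> > z} \<and>
              measure lebesgue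
                  {x \<in> {0..1}. \<bar>\<Sum>i=1..s. a i * f (idx i) x\<bar> > z}
                \<le> C * measure lebesgue
                  {x \<in> {0..1}. \<bar>\<Sum>i=1..s. a i * rademacher i x\<bar> > z / C})"
    proof (intro exI[of _ s] exI[of _ idx] conjI allI impI)
      show "max \<lfloor>log 2 (real N) / 6\<rfloor> 1 \<le> int s" using s_int by simp
      show "strict_mono_on {1..s} idx" 
        using B_less[OF idxB idxB] by (auto intro!: strict_mono_onI)
      show "1 \<le> idx 1" "idx s \<le> N" using idxB[of 1] idxB[of s] B_sub[of 1] B_sub[of s] s1 by auto
    next
      fix a :: "nat \<Rightarrow> real" and z :: real
      assume z: "z > 0"
      have R: "bmeas (lebesgue_on {0..1}) (\<lambda>x. \<Sum>i=1..s. a i * rademacher i x)"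
        by (intro bmeas_sum bmeas_mult bmeas_const bmeas_rademacher)
      note tails = AI.tail_equivalence[OF R rademacher_even_moment[OF s1] L C_def z, unfolded prob_lebesgue_01]
      show "(1 / C) * measure lebesgue {x \<in> {0..1}. \<bar>\<Sum>i=1..s. a i * rademacher i x\<bar> > C * z}
          \<le> measure lebesgue {x \<in> {0..1}. \<bar>\<Sum>i=1..s. a i * f (idx i) x\<bar> > z}"
        by (rule tails(1))
      show "measure lebesgue {x \<in> {0..1}. \<bar>\<Sum>i=1..s. a i * f (idx i) x\<bar> > z}
          \<le> C * measure lebesgue {x \<in> {0..1}. \<bar>\<Sum>i=1..s. a i * rademacher i x\<bar> > z / C}"
        by (rule tails(2))
    qed
  qed
qed

end
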